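(* Let $W$ be a process as in the context such that the associated process $\xi_W(t),t\in\mathbb{R}$, is max-stable and stationary. Let $\delta>0$ and put $W^\delta(i)=W(\delta i)$, $i\in\mathbb{Z}$. Then $$\lim_{|z|\to\infty,\,z\in\mathbb{Z}}W(z\delta)=-\infty\quad\text{almost surely}\qquad(\ast)$$ holds if and only if the following finite mean cluster size condition holds: there exists a sequence of positive integers $r_n$, $n\in\mathbb{N}$, with $\lim_{n\to\infty}r_n=\infty$ and $\lim_{n\to\infty}r_n/n=0$ such that for every $x>0$ $$\lim_{m\to\infty}\limsup_{n\to\infty}\mathbb{P}\Bigl\{\max_{m\le|k|\le r_n}\xi_W(k\delta)>nx\,\Big|\,\xi_W(0)>nx\Bigr\}=0 .$$ Moreover, if $(\ast)$ holds, then $$\mathcal{H}_W^\delta=\frac1\delta\,\mathbb{P}\Bigl\{\sup_{i<0}W^\delta(i)<0=\sup_{i\in\mathbb{Z}}W^\delta(i)\Bigr\} =\frac1\delta\,\mathbb{P}\Bigl\{\sup_{i\ge1}\bigl(\mathcal{E}+W^\delta(i)\bigr)\le0\Bigr\} =\frac1\delta\Bigl[\mathbb{E}\Bigl\{\sup_{i\ge0}e^{W^\delta(i)}\Bigr\}-\mathbb{E}\Bigl\{\sup_{i\ge1}e^{W^\delta(i)}\Bigr\}\Bigr],$$ and this value belongs to $(0,1/\delta)$. Here $i$ ranges over integers and $\mathcal{E}$ is a unit exponential random variable independent of $W$.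
   Context: Let $B(t),t\in\mathbb{R}$, be a real-valued random process with càdlàg sample paths, with $B(0)=0$ almost surely and $\mathbb{E}\{e^{B(t)}\}<\infty$ for all $t\in\mathbb{R}$. Set $W(t)=B(t)-\ln\mathbb{E}\{e^{B(t)}\}$, $t\in\mathbb{R}$, so that $W(0)=0$ almost surely and $\mathbb{E}\{e^{W(t)}\}=1$ for all $t$. Let $\sum_{i\ge1}\varepsilon_{P_i}$ be a Poisson point process on $(0,\infty)$ with intensity $x^{-2}dx$ ($\varepsilon_x$ is the unit Dirac measure at $x$), and let $W_i$, $i\ge1$, be independent copies of $W$, independent of this Poisson point process. Define $\xi_W(t)=\max_{i\ge1}P_ie^{W_i(t)}$, $t\in\mathbb{R}$; it is max-stable with unit Fréchet marginals. Stationarity of $\xi_W$ means that $\{\xi_W(t),t\in\mathbb{R}\}$ and $\{\xi_W(t+h),t\in\mathbb{R}\}$ have the same distribution for every $h\in\mathbb{R}$. For $\delta>0$ the Pickands-type constant is $$\mathcal{H}_W^\delta=\lim_{T\to\infty}\frac1T\,\mathbb{E}\Bigl\{\sup_{t\in\delta\mathbb{Z}\cap[0,T]}e^{W(t)}\Bigr\},$$ a limit which exists and is finite when $\xi_W$ is stationary.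
   Formalization: In the last expression both expectations are infinite under (∗), so their difference is undefined; it is read as the expectation of the difference, E{sup_{i≥0} e^{W^δ(i)} − sup_{i≥1} e^{W^δ(i)}}. *)

theory Defs
  imports "HOL-Probability.Probability"
begin

definition cadlag :: "(real \<Rightarrow> real) \<Rightarrow> bool" where
  "cadlag f \<longleftrightarrow> (\<forall>t. continuous (at_right t) f \<and> (\<exists>l. (f \<longlongrightarrow> l) (at_left t)))"

text \<open>Processes are functions \<open>X t \<omega>\<close>; their laws live on the product sigma-algebra, so
  equality of laws is equality of all finite-dimensional distributions.\<close>

abbreviation path_borel :: "('t \<Rightarrow> 'b::topological_space) measure" where
  "path_borel \<equiv> (\<Pi>\<^sub>M t\<in>UNIV. borel)"

definition process_law ::
    "'a measure \<Rightarrow> ('t \<Rightarrow> 'a \<Rightarrow> 'b::topological_space) \<Rightarrow> ('t \<Rightarrow> 'b) measure" where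
  "process_law M X = distr M path_borel (\<lambda>\<omega> t. X t \<omega>)"

definition stationary_process ::
    "'a measure \<Rightarrow> (real \<Rightarrow> 'a \<Rightarrow> 'b::topological_space) \<Rightarrow> bool" where
  "stationary_process M X \<longleftrightarrow> (\<forall>h. process_law M (\<lambda>t. X (t + h)) = process_law M X)"

text \<open>Max-stability with the norming of unit Frechet marginals (scale \<open>n\<close>, location \<open>0\<close>):
  the pointwise maximum of \<open>n\<close> independent copies, divided by \<open>n\<close>, has the original law.\<close>

definition max_stable_process :: "'a measure \<Rightarrow> ('t \<Rightarrow> 'a \<Rightarrow> ennreal) \<Rightarrow> bool" where
  "max_stable_process M X \<longleftrightarrow>
     (\<forall>n::nat. n \<ge> 1 \<longrightarrow>
        distr (\<Pi>\<^sub>M i\<in>{..<n}. process_law M X) path_borel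
              (\<lambda>x t. (SUP i\<in>{..<n}. x i t) / of_nat n)
        = process_law M X)"

text \<open>Independence of two random elements; unlike \<open>indep_var\<close>, the two value spaces may have
  different types.\<close>

definition indep_rv ::
    "'a measure \<Rightarrow> 'b measure \<Rightarrow> ('a \<Rightarrow> 'b) \<Rightarrow> 'c measure \<Rightarrow> ('a \<Rightarrow> 'c) \<Rightarrow> bool" where
  "indep_rv M S X T Y \<longleftrightarrow>
     X \<in> measurable M S \<and> Y \<in> measurable M T \<and>
     prob_space.indep_set M {X -` A \<inter> space M | A. A \<in> sets S} {Y -` A \<inter> space M | A. A \<in> sets T}"

text \<open>Counts are taken over indices, so points are counted with multiplicity.\<close>

definition point_count :: "(nat \<Rightarrow> 'a \<Rightarrow> 'b) \<Rightarrow> 'b set \<Rightarrow> 'a \<Rightarrow> ennreal" where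
  "point_count P A \<omega> = emeasure (count_space UNIV) {i. P i \<omega> \<in> A}"

text \<open>\<open>P\<close> enumerates the points of a Poisson point process with sigma-finite infinite intensity
  measure \<open>\<mu>\<close> on the space of \<open>\<mu>\<close>. That sets of infinite intensity contain infinitely many points
  almost surely is a consequence of the clauses below. The Poisson probabilities are written out
  because \<open>poisson_pmf\<close> excludes rate \<open>0\<close>.\<close>

definition poisson_point_process ::
    "'a measure \<Rightarrow> 'b measure \<Rightarrow> (nat \<Rightarrow> 'a \<Rightarrow> 'b) \<Rightarrow> bool" where
  "poisson_point_process M \<mu> P \<longleftrightarrow>
     (\<forall>i. P i \<in> measurable M \<mu>) \<and>
     (\<forall>A\<in>sets \<mu>. emeasure \<mu> A < \<infinity> \<longrightarrow>
        (\<forall>k::nat. \<P>(\<omega> in M. point_count P A \<omega> = of_nat k)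
                   = measure \<mu> A ^ k / fact k * exp (- measure \<mu> A))) \<and>
     (\<forall>(I::nat set) A. finite I \<longrightarrow> A ` I \<subseteq> sets \<mu> \<longrightarrow> disjoint_family_on A I \<longrightarrow>
        prob_space.indep_vars M (\<lambda>_. borel) (\<lambda>j. point_count P (A j)) I)"

definition frechet_intensity :: "real measure" where
  "frechet_intensity = density (restrict_space lborel {0<..}) (\<lambda>x. ennreal (1 / x\<^sup>2))"

definition exp_normalized :: "'a measure \<Rightarrow> (real \<Rightarrow> 'a \<Rightarrow> real) \<Rightarrow> real \<Rightarrow> 'a \<Rightarrow> real" where
  "exp_normalized M B t \<omega> = B t \<omega> - ln (LINT \<eta>|M. exp (B t \<eta>))"

text \<open>Indices start at \<open>0\<close>. The values are extended non-negative reals, so the supremum always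
  exists.\<close>

definition spectral_sup ::
    "(nat \<Rightarrow> 'a \<Rightarrow> real) \<Rightarrow> (nat \<Rightarrow> real \<Rightarrow> 'a \<Rightarrow> real) \<Rightarrow> real \<Rightarrow> 'a \<Rightarrow> ennreal" where
  "spectral_sup P V t \<omega> = (SUP i. ennreal (P i \<omega> * exp (V i t \<omega>)))"

text \<open>The inner \<open>SUP\<close> ranges over the integers \<open>k\<close> with \<open>m \<le> \<bar>k\<bar> \<le> r n\<close>; for
  \<open>r n < m\<close> it is \<open>0\<close>, which does not affect the limit superior since \<open>r\<close> diverges.\<close>

definition finite_mean_cluster_size ::
    "'a measure \<Rightarrow> (real \<Rightarrow> 'a \<Rightarrow> ennreal) \<Rightarrow> real \<Rightarrow> bool" where
  "finite_mean_cluster_size M \<xi> \<delta> \<longleftrightarrow>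
     (\<exists>r::nat \<Rightarrow> nat. (\<forall>n. r n > 0) \<and> filterlim r at_top sequentially \<and>
        (\<lambda>n. real (r n) / real n) \<longlonglongrightarrow> 0 \<and>
        (\<forall>x::real. x > 0 \<longrightarrow>
           (\<lambda>m::nat. limsup (\<lambda>n. ereal
               (\<P>(\<omega> in M. (SUP k\<in>{k::int. int m \<le> \<bar>k\<bar> \<and> \<bar>k\<bar> \<le> int (r n)}. \<xi> (of_int k * \<delta>) \<omega>)
                               > ennreal (real n * x)
                         \<bar> \<xi> 0 \<omega> > ennreal (real n * x)))))
           \<longlonglongrightarrow> 0))"

definition pickands_ratio :: "'a measure \<Rightarrow> (real \<Rightarrow> 'a \<Rightarrow> real) \<Rightarrow> real \<Rightarrow> real \<Rightarrow> real" where
  "pickands_ratio M W \<delta> T =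
     1 / T * (LINT \<omega>|M. (SUP t\<in>range (\<lambda>k::int. \<delta> * of_int k) \<inter> {0..T}. exp (W t \<omega>)))"

definition pickands :: "'a measure \<Rightarrow> (real \<Rightarrow> 'a \<Rightarrow> real) \<Rightarrow> real \<Rightarrow> real" where
  "pickands M W \<delta> = Lim at_top (pickands_ratio M W \<delta>)"

text \<open>The difference of the expectations of \<open>sup\<^bsub>i\<ge>0\<^esub> exp (V i)\<close> and \<open>sup\<^bsub>i\<ge>1\<^esub> exp (V i)\<close>,
  understood as the expectation of the difference: in the stationary case with \<open>V i \<rightarrow> -\<infinity>\<close> both
  expectations are infinite, while the two suprema are almost surely finite with difference
  in \<open>[0, 1]\<close>.\<close>

definition sup_exp_increment :: "'a measure \<Rightarrow> (int \<Rightarrow> 'a \<Rightarrow> real) \<Rightarrow> real" where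
  "sup_exp_increment M V =
     enn2real (\<integral>\<^sup>+\<omega>. ((SUP i\<in>{0..}. ennreal (exp (V i \<omega>))) - (SUP i\<in>{1..}. ennreal (exp (V i \<omega>)))) \<partial>M)"

end

theory Submission
  imports Defs
begin

text \<open>Write \<open>X\<^sub>k = exp (W (k \<delta>))\<close>, so that the \<open>X\<^sub>k\<close> have mean \<open>1\<close> and \<open>X\<^sub>0 = 1\<close>. The generating functional
  of the Poisson process gives \<open>P(\<xi>(t\<^sub>i) \<le> x\<^sub>i for all i) = exp (- E max\<^sub>i exp (W t\<^sub>i) / x\<^sub>i)\<close>. Since
  \<open>r\<^sub>n/n \<rightarrow> 0\<close>, the conditional probability in the cluster condition converges to
  \<open>E min 1 (sup X\<^sub>k)\<close>, the supremum being taken over \<open>\<bar>k\<bar> \<ge> m\<close>; this tends to \<open>0\<close> as \<open>m\<close> grows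
  exactly if \<open>X\<^sub>k \<rightarrow> 0\<close> almost surely.

  Stationarity says that the functionals \<open>E max\<^sub>i c\<^sub>i X\<^bsub>k(i)\<^esub>\<close> are invariant under shifts. On the one hand,
  \<open>E max\<^bsub>0\<le>k\<le>n\<^esub> X\<^sub>k\<close> therefore has increments \<open>E (1 - max\<^bsub>1\<le>k\<le>n\<^esub> X\<^sub>k)\<^sup>+\<close>, and averaging gives
  \<open>\<delta> H = E (1 - sup\<^bsub>k\<ge>1\<^esub> X\<^sub>k)\<^sup>+\<close>. On the other hand, differentiating \<open>s \<mapsto> E max (s X\<^sub>h) (max\<^sub>j c\<^sub>j X\<^bsub>j+h\<^esub>)\<close>
  at \<open>s = 1\<close> shows that under the tilted law \<open>E (X\<^sub>h; _)\<close> the sequence \<open>X\<^bsub>j+h\<^esub>/X\<^sub>h\<close> is distributed as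
  \<open>X\<^sub>j\<close>. Splitting \<open>sup\<^bsub>k\<ge>0\<^esub> X\<^sub>k - sup\<^bsub>k\<ge>1\<^esub> X\<^sub>k\<close> according to the location of the first maximum and moving that
  location to \<open>0\<close> by the tilt produces a telescoping sum, so \<open>\<delta> H\<close> is the probability that the first
  maximum is at \<open>0\<close>.\<close>

subsection \<open>Independent random elements\<close>

text \<open>Independence is the product formula on measurable rectangles, and rectangles determine a
  product of sigma-finite measures.\<close>

lemma (in prob_space) indep_rv_distr_pair:
  assumes "indep_rv M S X T Y"
  shows "distr M S X \<Otimes>\<^sub>M distr M T Y = distr M (S \<Otimes>\<^sub>M T) (\<lambda>\<omega>. (X \<omega>, Y \<omega>))"
proof (rule pair_measure_eqI)
  have [measurable]: "X \<in> M \<rightarrow>\<^sub>M S" "Y \<in> M \<rightarrow>\<^sub>M T"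
    and indep: "indep_set {X -` A \<inter> space M |A. A \<in> sets S} {Y -` A \<inter> space M |A. A \<in> sets T}"
    using assms unfolding indep_rv_def by auto
  show "sigma_finite_measure (distr M S X)" "sigma_finite_measure (distr M T Y)"
    by (auto intro!: prob_space_distr prob_space_imp_sigma_finite)
  show "sets (distr M S X \<Otimes>\<^sub>M distr M T Y) = sets (distr M (S \<Otimes>\<^sub>M T) (\<lambda>\<omega>. (X \<omega>, Y \<omega>)))"
    by (simp cong: sets_pair_measure_cong)
  fix A B assume "A \<in> sets (distr M S X)" "B \<in> sets (distr M T Y)"
  then have [measurable]: "A \<in> sets S" "B \<in> sets T" by auto
  have "(\<lambda>\<omega>. (X \<omega>, Y \<omega>)) -` (A \<times> B) \<inter> space M = (X -` A \<inter> space M) \<inter> (Y -` B \<inter> space M)"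
    by auto
  moreover have "prob ((X -` A \<inter> space M) \<inter> (Y -` B \<inter> space M))
      = prob (X -` A \<inter> space M) * prob (Y -` B \<inter> space M)"
    by (rule indep_setD[OF indep]) auto
  ultimately show "emeasure (distr M S X) A * emeasure (distr M T Y) B
      = emeasure (distr M (S \<Otimes>\<^sub>M T) (\<lambda>\<omega>. (X \<omega>, Y \<omega>))) (A \<times> B)"
    by (simp add: emeasure_distr emeasure_eq_measure ennreal_mult'' del: vimage_Int)
qed

lemma (in prob_space) indep_rv_sym:
  assumes "indep_rv M S X T Y"
  shows "indep_rv M T Y S X"
proof -
  have [measurable]: "X \<in> M \<rightarrow>\<^sub>M S" "Y \<in> M \<rightarrow>\<^sub>M T"
    and indep: "indep_set {X -` A \<inter> space M |A. A \<in> sets S} {Y -` A \<inter> space M |A. A \<in> sets T}"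
    using assms unfolding indep_rv_def by auto
  have "indep_set {Y -` A \<inter> space M |A. A \<in> sets T} {X -` A \<inter> space M |A. A \<in> sets S}"
  proof (rule indep_setI)
    fix a b assume "a \<in> {Y -` A \<inter> space M |A. A \<in> sets T}" "b \<in> {X -` A \<inter> space M |A. A \<in> sets S}"
    then have "prob (b \<inter> a) = prob b * prob a"
      by (intro indep_setD[OF indep])
    then show "prob (a \<inter> b) = prob a * prob b"
      by (simp add: Int_commute mult.commute)
  qed (use indep_setD_ev1[OF indep] indep_setD_ev2[OF indep] in auto)
  then show ?thesis
    unfolding indep_rv_def by simp
qed

text \<open>Fubini for the product law: the first element is frozen and the second is integrated
  out. This replaces conditioning, first on the Poisson points and later on the path of
  \<open>W\<close>.\<close>

lemma (in prob_space) indep_rv_emeasure: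
  assumes "indep_rv M S X T Y" and A: "A \<in> sets (S \<Otimes>\<^sub>M T)"
  shows "emeasure M {\<omega>\<in>space M. (X \<omega>, Y \<omega>) \<in> A}
    = (\<integral>\<^sup>+\<omega>. emeasure M {\<eta>\<in>space M. (X \<omega>, Y \<eta>) \<in> A} \<partial>M)"
proof -
  have [measurable]: "X \<in> M \<rightarrow>\<^sub>M S" "Y \<in> M \<rightarrow>\<^sub>M T"
    using assms unfolding indep_rv_def by auto
  interpret Y: prob_space "distr M T Y" by (rule prob_space_distr) simp
  have A': "A \<in> sets (distr M S X \<Otimes>\<^sub>M distr M T Y)"
    using A by (simp cong: sets_pair_measure_cong)
  have "emeasure M {\<omega>\<in>space M. (X \<omega>, Y \<omega>) \<in> A} = emeasure (distr M S X \<Otimes>\<^sub>M distr M T Y) A"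
    unfolding indep_rv_distr_pair[OF assms(1)] using A
    by (subst emeasure_distr) (auto intro!: arg_cong[where f="emeasure M"])
  also have "\<dots> = (\<integral>\<^sup>+x. emeasure (distr M T Y) (Pair x -` A) \<partial>distr M S X)"
    by (rule Y.emeasure_pair_measure_alt[OF A'])
  also have "\<dots> = (\<integral>\<^sup>+\<omega>. emeasure (distr M T Y) (Pair (X \<omega>) -` A) \<partial>M)"
    using Y.measurable_emeasure_Pair[OF A'] by (subst nn_integral_distr) auto
  also have "\<dots> = (\<integral>\<^sup>+\<omega>. emeasure M {\<eta>\<in>space M. (X \<omega>, Y \<eta>) \<in> A} \<partial>M)"
  proof (rule nn_integral_cong)
    fix \<omega> assume "\<omega> \<in> space M"
    then show "emeasure (distr M T Y) (Pair (X \<omega>) -` A) = emeasure M {\<eta>\<in>space M. (X \<omega>, Y \<eta>) \<in> A}"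
      using A by (subst emeasure_distr)
        (auto intro!: arg_cong[where f="emeasure M"] sets_Pair1)
  qed
  finally show ?thesis .
qed

subsection \<open>Poisson point processes\<close>

text \<open>Measurability of a count is implicit in the definition: independence of a family indexed
  by a single element contains it.\<close>

lemma (in prob_space) point_count_measurable:
  assumes "poisson_point_process M \<mu> P" and "A \<in> sets \<mu>"
  shows "point_count P A \<in> borel_measurable M"
proof -
  have "indep_vars (\<lambda>_. borel) (\<lambda>j. point_count P A) {0::nat}"
    using assms unfolding poisson_point_process_def
    by (elim conjE allE[where x="{0::nat}"] allE[where x="\<lambda>_. A"]) (auto simp: disjoint_family_on_def)
  then show ?thesis
    unfolding indep_vars_def by auto
qed

text \<open>The exponential series summed against the Poisson weights. The integrand is a series
  over the finite values of the count, because finiteness of the count is not yet available; the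
  case \<open>c = 1\<close> will supply it.\<close>

lemma (in prob_space) point_count_pgf_aux:
  assumes P: "poisson_point_process M \<mu> P" and A: "A \<in> sets \<mu>" "emeasure \<mu> A < \<infinity>"
    and c: "0 \<le> c"
  shows "(\<integral>\<^sup>+\<omega>. (\<Sum>k. ennreal (c ^ k) * indicator {\<omega>\<in>space M. point_count P A \<omega> = of_nat k} \<omega>) \<partial>M)
    = ennreal (exp (- ((1 - c) * measure \<mu> A)))"
proof -
  note [measurable] = point_count_measurable[OF P A(1)]
  let ?l = "measure \<mu> A"
  have p: "emeasure M {\<omega>\<in>space M. point_count P A \<omega> = of_nat k} = ennreal (?l ^ k / fact k * exp (- ?l))" for k
    using P A unfolding poisson_point_process_def by (auto simp: emeasure_eq_measure)
  have s: "(\<lambda>k. c ^ k * (?l ^ k / fact k * exp (- ?l))) sums (exp (c * ?l) * exp (- ?l))"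
    using sums_mult2[OF exp_converges[of "c * ?l"], of "exp (- ?l)"]
    by (simp add: field_simps)
  have "(\<integral>\<^sup>+\<omega>. (\<Sum>k. ennreal (c ^ k) * indicator {\<omega>\<in>space M. point_count P A \<omega> = of_nat k} \<omega>) \<partial>M)
      = (\<Sum>k. ennreal (c ^ k) * ennreal (?l ^ k / fact k * exp (- ?l)))"
    by (subst nn_integral_suminf) (auto simp: nn_integral_cmult p)
  also have "\<dots> = (\<Sum>k. ennreal (c ^ k * (?l ^ k / fact k * exp (- ?l))))"
    using c by (intro suminf_cong ennreal_mult[symmetric]) auto
  also have "\<dots> = ennreal (exp (c * ?l) * exp (- ?l))"
    using s c by (intro suminf_ennreal_eq) (auto intro!: mult_nonneg_nonneg divide_nonneg_nonneg)
  finally show ?thesis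
    by (simp add: exp_add[symmetric] algebra_simps)
qed

text \<open>The Poisson weights sum to 1, which leaves no mass for an infinite count.\<close>

lemma (in prob_space) AE_point_count_finite:
  assumes P: "poisson_point_process M \<mu> P" and A: "A \<in> sets \<mu>" "emeasure \<mu> A < \<infinity>"
  shows "AE \<omega> in M. finite {i. P i \<omega> \<in> A}"
proof -
  note [measurable] = point_count_measurable[OF P A(1)]
  have "(\<Sum>k. indicator {\<omega>\<in>space M. point_count P A \<omega> = of_nat k} \<omega>)
      = (indicator {\<omega>\<in>space M. \<exists>k::nat. point_count P A \<omega> = of_nat k} \<omega> :: ennreal)" for \<omega>
    by (subst suminf_indicator) (auto simp: disjoint_family_on_def intro!: arg_cong[where f="\<lambda>S. indicator S \<omega>"])
  then have "emeasure M {\<omega>\<in>space M. \<exists>k::nat. point_count P A \<omega> = of_nat k} = 1"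
    using point_count_pgf_aux[OF assms, of 1] by simp
  then have "AE \<omega> in M. \<exists>k::nat. point_count P A \<omega> = of_nat k"
    by (simp add: emeasure_eq_measure prob_Collect_eq_1)
  then show ?thesis
  proof eventually_elim
    case (elim \<omega>)
    then obtain k :: nat where "point_count P A \<omega> = of_nat k" ..
    then show ?case
      unfolding point_count_def by (auto simp: emeasure_count_space split: if_splits)
  qed
qed

text \<open>Almost surely the count is a natural number, which the rounding in the exponent
  recovers; the integrand then differs from the series above only on a null set.\<close>

lemma (in prob_space) point_count_pgf:
  assumes P: "poisson_point_process M \<mu> P" and A: "A \<in> sets \<mu>" "emeasure \<mu> A < \<infinity>"
    and c: "0 \<le> c"
  shows "(\<integral>\<^sup>+\<omega>. ennreal (c ^ nat \<lfloor>enn2real (point_count P A \<omega>)\<rfloor>) \<partial>M)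
    = ennreal (exp (- ((1 - c) * measure \<mu> A)))"
  unfolding point_count_pgf_aux[OF assms, symmetric]
proof (rule nn_integral_cong_AE)
  show "AE \<omega> in M. ennreal (c ^ nat \<lfloor>enn2real (point_count P A \<omega>)\<rfloor>) =
      (\<Sum>k. ennreal (c ^ k) * indicator {\<omega>\<in>space M. point_count P A \<omega> = of_nat k} \<omega>)"
    using AE_point_count_finite[OF P A] AE_space
  proof eventually_elim
    case (elim \<omega>)
    let ?k = "card {i. P i \<omega> \<in> A}"
    have k: "point_count P A \<omega> = of_nat ?k"
      using elim unfolding point_count_def by (simp add: emeasure_count_space)
    have "(\<Sum>k. ennreal (c ^ k) * indicator {\<omega>\<in>space M. point_count P A \<omega> = of_nat k} \<omega>)
      = (\<Sum>k\<in>{?k}. ennreal (c ^ k) * indicator {\<omega>\<in>space M. point_count P A \<omega> = of_nat k} \<omega>)"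
      using elim by (intro suminf_finite) (auto simp: k)
    then show ?case
      using elim by (simp add: k)
  qed
qed

text \<open>Group the points by the value of \<open>h\<close>. The infinite product, written as the
  infimum of its partial products, becomes a finite product of powers \<open>(1 - v) ^ N v\<close>
  over the nonzero values \<open>v\<close>; the counts of the disjoint level sets are independent,
  and each factor is a Poisson generating function.\<close>

lemma (in prob_space) poisson_point_process_pgf_simple:
  assumes P: "poisson_point_process M \<mu> P"
    and h: "simple_function \<mu> h" "integrable \<mu> h" "\<And>x. 0 \<le> h x" "\<And>x. h x \<le> (1::real)"
  shows "(\<integral>\<^sup>+\<omega>. (INF k. ennreal (\<Prod>i<k. 1 - h (P i \<omega>))) \<partial>M) = ennreal (exp (- integral\<^sup>L \<mu> h))"
proof -
  define V where "V = h ` space \<mu> - {0}"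
  define A where "A v = h -` {v} \<inter> space \<mu>" for v
  have V: "finite V" "\<And>v. v \<in> V \<Longrightarrow> 0 \<le> v \<and> v \<le> 1"
    using h unfolding V_def simple_function_def by auto
  have A: "A v \<in> sets \<mu>" for v
    unfolding A_def using h(1) by (rule simple_functionD)
  \<comment> \<open>Markov's inequality for the level sets of the integrable function
    \<open>h\<close>.\<close>
  have Afin: "emeasure \<mu> (A v) < \<infinity>" if "v \<in> V" for v
  proof -
    have "v > 0" using that V h(3) by (auto simp: V_def order.order_iff_strict)
    then have "ennreal v * emeasure \<mu> (A v) = (\<integral>\<^sup>+x. ennreal v * indicator (A v) x \<partial>\<mu>)"
      using A by (simp add: nn_integral_cmult)
    also have "\<dots> \<le> (\<integral>\<^sup>+x. ennreal (h x) \<partial>\<mu>)"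
      by (intro nn_integral_mono) (auto simp: A_def indicator_def)
    also have "\<dots> < \<infinity>"
      using h(2,3) by (simp add: nn_integral_eq_integral)
    finally have "emeasure \<mu> (A v) = 0 \<or> emeasure \<mu> (A v) < \<infinity>"
      using \<open>v > 0\<close> unfolding infinity_ennreal_def ennreal_mult_less_top by simp
    then show ?thesis
      by (elim disjE) simp_all
  qed
  have PR: "P i \<omega> \<in> space \<mu>" if "\<omega> \<in> space M" for i \<omega>
    using P that unfolding poisson_point_process_def by (auto dest: measurable_space)
  have int: "integral\<^sup>L \<mu> h = (\<Sum>v\<in>V. v * measure \<mu> (A v))"
  proof -
    have "integral\<^sup>L \<mu> h = (\<integral>x. (\<Sum>v\<in>V. v * indicator (A v) x) \<partial>\<mu>)"
    proof (rule Bochner_Integration.integral_cong[OF refl])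
      fix x assume x: "x \<in> space \<mu>"
      have "(\<Sum>v\<in>V. v * indicator (A v) x) = (\<Sum>v\<in>V. if v = h x then v else 0)"
        using x by (intro sum.cong) (auto simp: A_def)
      also have "\<dots> = h x"
        using x V(1) by (subst sum.delta) (auto simp: V_def)
      finally show "h x = (\<Sum>v\<in>V. v * indicator (A v) x)" by simp
    qed
    also have "\<dots> = (\<Sum>v\<in>V. v * measure \<mu> (A v))"
      using A Afin by (subst Bochner_Integration.integral_sum) auto
    finally show ?thesis .
  qed
  define N where "N v \<omega> = nat \<lfloor>enn2real (point_count P (A v) \<omega>)\<rfloor>" for v \<omega>
  have "AE \<omega> in M. \<forall>v\<in>V. finite {i. P i \<omega> \<in> A v}"
    using V(1) AE_point_count_finite[OF P A Afin] by (simp add: AE_finite_all)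
  then have "AE \<omega> in M. (INF k. ennreal (\<Prod>i<k. 1 - h (P i \<omega>))) = (\<Prod>v\<in>V. ennreal ((1 - v) ^ N v \<omega>))"
    using AE_space
  proof eventually_elim
    case (elim \<omega>)
    define I where "I v = {i. P i \<omega> \<in> A v}" for v
    have N: "N v \<omega> = card (I v)" if "v \<in> V" for v
      using elim that unfolding N_def I_def point_count_def by (simp add: emeasure_count_space)
    have finI: "finite (\<Union>v\<in>V. I v)" "\<And>v. v \<in> V \<Longrightarrow> finite (I v)"
      using elim V(1) unfolding I_def by auto
    \<comment> \<open>All indices with \<open>h (P i \<omega>)\<close> nonzero lie below
      \<open>n\<close>, so the decreasing partial products are constant from \<open>n\<close> on and
      the constant is their infimum.\<close>
    then obtain n where n: "(\<Union>v\<in>V. I v) \<subseteq> {..<n}"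
      using finite_nat_iff_bounded by blast
    have out: "h (P i \<omega>) = 0" if "i \<notin> (\<Union>v\<in>V. I v)" for i
      using that PR[OF elim(2), of i] unfolding I_def V_def A_def by auto
    have eq: "(\<Prod>i<k. 1 - h (P i \<omega>)) = (\<Prod>v\<in>V. (1 - v) ^ N v \<omega>)" if "n \<le> k" for k
    proof -
      have "(\<Prod>i<k. 1 - h (P i \<omega>)) = (\<Prod>i\<in>(\<Union>v\<in>V. I v). 1 - h (P i \<omega>))"
        using n that out by (intro prod.mono_neutral_right) auto
      also have "\<dots> = (\<Prod>v\<in>V. \<Prod>i\<in>I v. 1 - h (P i \<omega>))"
        using V(1) finI by (intro prod.UNION_disjoint) (auto simp: I_def A_def)
      also have "\<dots> = (\<Prod>v\<in>V. (1 - v) ^ N v \<omega>)"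
        by (intro prod.cong refl) (simp add: N, simp add: I_def A_def)
      finally show ?thesis .
    qed
    have dec: "decseq (\<lambda>k. ennreal (\<Prod>i<k. 1 - h (P i \<omega>)))"
      using h by (intro decseq_SucI ennreal_leI) (auto intro!: mult_left_le prod_nonneg)
    have "(\<lambda>k. ennreal (\<Prod>i<k. 1 - h (P i \<omega>))) \<longlonglongrightarrow> ennreal (\<Prod>v\<in>V. (1 - v) ^ N v \<omega>)"
      using eq by (intro tendsto_eventually eventually_sequentiallyI[of n]) simp
    then have "(INF k. ennreal (\<Prod>i<k. 1 - h (P i \<omega>))) = ennreal (\<Prod>v\<in>V. (1 - v) ^ N v \<omega>)"
      using LIMSEQ_INF[OF dec] LIMSEQ_unique by blast
    then show ?case
      using V(2) by (simp add: prod_ennreal)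
  qed
  then have "(\<integral>\<^sup>+\<omega>. (INF k. ennreal (\<Prod>i<k. 1 - h (P i \<omega>))) \<partial>M) = (\<integral>\<^sup>+\<omega>. (\<Prod>v\<in>V. ennreal ((1 - v) ^ N v \<omega>)) \<partial>M)"
    by (rule nn_integral_cong_AE)
  also have "\<dots> = (\<Prod>v\<in>V. \<integral>\<^sup>+\<omega>. ennreal ((1 - v) ^ N v \<omega>) \<partial>M)"
  proof -
    \<comment> \<open>Independence of counts is given for families indexed by natural numbers, so
      the values in \<open>V\<close> are enumerated.\<close>
    obtain f :: "nat \<Rightarrow> real" and n where f: "f ` {..<n} = V" "inj_on f {..<n}"
      using finite_imp_nat_seg_image_inj_on[OF V(1)] by (auto simp: lessThan_def)
    have "disjoint_family_on (\<lambda>j. A (f j)) {..<n}"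
      using f(2) by (auto simp: disjoint_family_on_def A_def inj_on_def)
    then have "indep_vars (\<lambda>_. borel) (\<lambda>j. point_count P (A (f j))) {..<n}"
      using P A unfolding poisson_point_process_def
      by (elim conjE allE[where x="{..<n}"] allE[where x="\<lambda>j. A (f j)"]) (simp add: image_subset_iff)
    then have "indep_vars (\<lambda>_. borel) (\<lambda>j \<omega>. (\<lambda>x. ennreal ((1 - f j) ^ nat \<lfloor>enn2real x\<rfloor>)) (point_count P (A (f j)) \<omega>)) {..<n}"
      by (rule indep_vars_compose2) measurable
    then have "(\<integral>\<^sup>+\<omega>. (\<Prod>j<n. ennreal ((1 - f j) ^ N (f j) \<omega>)) \<partial>M) = (\<Prod>j<n. \<integral>\<^sup>+\<omega>. ennreal ((1 - f j) ^ N (f j) \<omega>) \<partial>M)"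
      unfolding N_def by (intro indep_vars_nn_integral) auto
    then show ?thesis
      using f by (simp add: f(1)[symmetric] prod.reindex)
  qed
  also have "\<dots> = (\<Prod>v\<in>V. ennreal (exp (- (v * measure \<mu> (A v)))))"
    unfolding N_def using V(2) by (intro prod.cong refl) (simp add: point_count_pgf[OF P A Afin])
  also have "\<dots> = ennreal (exp (- integral\<^sup>L \<mu> h))"
    using V(1) by (simp add: prod_ennreal int exp_sum[symmetric] sum_negf)
  finally show ?thesis .
qed

text \<open>Simple functions increase to \<open>h\<close>, so the products decrease. The infimum
  over the approximation commutes with the infimum over the partial products, and decreasing
  monotone convergence, valid because the integrals are finite, moves it out of the
  expectation.\<close>

lemma (in prob_space) poisson_point_process_pgf:
  assumes P: "poisson_point_process M \<mu> P"
    and h: "integrable \<mu> h" "\<And>x. 0 \<le> h x" "\<And>x. h x \<le> (1::real)"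
  shows "(\<integral>\<^sup>+\<omega>. (INF k. ennreal (\<Prod>i<k. 1 - h (P i \<omega>))) \<partial>M) = ennreal (exp (- integral\<^sup>L \<mu> h))"
proof -
  have [measurable]: "h \<in> borel_measurable \<mu>" "\<And>i. P i \<in> M \<rightarrow>\<^sub>M \<mu>"
    using h P unfolding poisson_point_process_def by auto
  obtain f where f: "incseq f" "\<And>i. simple_function \<mu> (f i)" "\<And>x. bdd_above (range (\<lambda>i. f i x))"
    "\<And>i x. 0 \<le> f i x" "h = (SUP i. f i)"
    using borel_measurable_implies_simple_function_sequence_real[of h \<mu>] h by auto
  have [measurable]: "\<And>i. f i \<in> borel_measurable \<mu>"
    using f(2) by (rule borel_measurable_simple_function)
  have inc: "incseq (\<lambda>i. f i x)" for x
    using f(1) by (auto simp: incseq_def le_fun_def)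
  have lim: "(\<lambda>i. f i x) \<longlonglongrightarrow> h x" for x
    unfolding f(5) SUP_apply using f(3) inc by (rule LIMSEQ_incseq_SUP)
  have le: "f i x \<le> h x" for i x
    using inc lim by (rule incseq_le)
  have le1: "f i x \<le> 1" for i x
    using le h(3) order_trans by blast
  have int: "integrable \<mu> (f i)" for i
    using f(4) le by (intro Bochner_Integration.integrable_bound[OF h(1)]) (auto simp: h(2))
  have "(\<lambda>n. integral\<^sup>L \<mu> (f n)) \<longlonglongrightarrow> integral\<^sup>L \<mu> h"
    using f(4) le lim by (intro integral_dominated_convergence[where w=h] h(1)) auto
  then have R: "(\<lambda>n. ennreal (exp (- integral\<^sup>L \<mu> (f n)))) \<longlonglongrightarrow> ennreal (exp (- integral\<^sup>L \<mu> h))"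
    by (intro tendsto_ennrealI tendsto_intros)
  define Q where "Q n \<omega> = (INF k. ennreal (\<Prod>i<k. 1 - f n (P i \<omega>)))" for n \<omega>
  have [measurable]: "Q n \<in> borel_measurable M" for n
    unfolding Q_def by measurable
  have dec0: "ennreal (\<Prod>i<k. 1 - f n (P i \<omega>)) \<le> ennreal (\<Prod>i<k. 1 - f m (P i \<omega>))" if "m \<le> n" for k n m \<omega>
    using incseqD[OF inc that] le1 by (intro ennreal_leI prod_mono) (auto simp: f(4))
  have dec: "decseq Q"
    unfolding Q_def using dec0 by (intro antimonoI le_funI INF_mono) blast
  have Qint: "integral\<^sup>N M (Q n) = ennreal (exp (- integral\<^sup>L \<mu> (f n)))" for n
    unfolding Q_def by (rule poisson_point_process_pgf_simple[OF P f(2) int f(4) le1])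
  have "(\<integral>\<^sup>+\<omega>. (INF k. ennreal (\<Prod>i<k. 1 - h (P i \<omega>))) \<partial>M) = (\<integral>\<^sup>+\<omega>. (INF n. Q n \<omega>) \<partial>M)"
  proof (rule nn_integral_cong)
    fix \<omega>
    have "(INF n. ennreal (\<Prod>i<k. 1 - f n (P i \<omega>))) = ennreal (\<Prod>i<k. 1 - h (P i \<omega>))" for k
    proof (rule LIMSEQ_unique[OF LIMSEQ_INF])
      show "decseq (\<lambda>n. ennreal (\<Prod>i<k. 1 - f n (P i \<omega>)))"
        using dec0 by (simp add: decseq_def)
      show "(\<lambda>n. ennreal (\<Prod>i<k. 1 - f n (P i \<omega>))) \<longlonglongrightarrow> ennreal (\<Prod>i<k. 1 - h (P i \<omega>))"
        by (intro tendsto_ennrealI tendsto_intros lim)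
    qed
    then show "(INF k. ennreal (\<Prod>i<k. 1 - h (P i \<omega>))) = (INF n. Q n \<omega>)"
      unfolding Q_def by (subst INF_commute) simp
  qed
  also have "\<dots> = (INF n. integral\<^sup>N M (Q n))"
    using dec by (intro nn_integral_monotone_convergence_INF_decseq[of _ _ 0]) (auto simp: Qint)
  also have "\<dots> = ennreal (exp (- integral\<^sup>L \<mu> h))"
  proof (rule LIMSEQ_unique[OF LIMSEQ_INF])
    show "decseq (\<lambda>n. integral\<^sup>N M (Q n))"
      by (intro antimonoI nn_integral_mono le_funD[OF antimonoD[OF dec]])
    show "(\<lambda>n. integral\<^sup>N M (Q n)) \<longlonglongrightarrow> ennreal (exp (- integral\<^sup>L \<mu> h))"
      unfolding Qint by (rule R)
  qed
  finally show ?thesis .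
qed

subsection \<open>Finite-dimensional distributions of the max-stable process\<close>

lemma space_frechet_intensity [simp]: "space frechet_intensity = {0<..}"
  by (simp add: frechet_intensity_def space_restrict_space)

lemma measurable_frechet_intensity_borel:
  "(\<lambda>x. x) \<in> frechet_intensity \<rightarrow>\<^sub>M borel"
  unfolding frechet_intensity_def
  by (subst measurable_cong_sets[OF sets_density refl]) (simp add: measurable_restrict_space1)

lemma emeasure_frechet_intensity_greaterThan:
  assumes "0 < a"
  shows "emeasure frechet_intensity {a<..} = ennreal (1 / a)"
proof -
  have sub: "{a<..} \<subseteq> {0<..}" using assms by auto
  then have s: "{a<..} \<in> sets (restrict_space lborel {0<..})"
    by (simp add: sets_restrict_space_iff)
  have "emeasure frechet_intensity {a<..}
      = (\<integral>\<^sup>+x. ennreal (1 / x\<^sup>2) * indicator {a<..} x \<partial>restrict_space lborel {0<..})"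
    unfolding frechet_intensity_def
    by (rule emeasure_density[OF _ s]) (intro measurable_restrict_space1, measurable)
  also have "\<dots> = (\<integral>\<^sup>+x. ennreal (1 / x\<^sup>2) * indicator {a<..} x * indicator {0<..} x \<partial>lborel)"
    by (subst nn_integral_restrict_space) auto
  \<comment> \<open>The endpoint \<open>a\<close>, a null set, is added so that the fundamental
    theorem applies on a closed half-line, with antiderivative \<open>- 1 / x\<close>.\<close>
  also have "\<dots> = (\<integral>\<^sup>+x. ennreal (1 / x\<^sup>2) * indicator {a..} x \<partial>lborel)"
    using AE_lborel_singleton[of a]
    by (intro nn_integral_cong_AE, eventually_elim) (use assms in \<open>auto simp: indicator_def\<close>)
  also have "\<dots> = ennreal (0 - (- 1 / a))"
  proof (rule nn_integral_FTC_atLeast)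
    show "((\<lambda>x. - 1 / x) has_real_derivative 1 / x\<^sup>2) (at x)" if "a \<le> x" for x
      using that assms by (auto intro!: derivative_eq_intros simp: power2_eq_square)
    show "((\<lambda>x::real. - 1 / x) \<longlongrightarrow> 0) at_top"
      by (intro tendsto_divide_0[OF tendsto_const] filterlim_at_top_imp_at_infinity filterlim_ident)
  qed auto
  finally show ?thesis by simp
qed

text \<open>The set is the half-line above the reciprocal of the largest \<open>y i\<close>. This is
  the origin of the maximum in the exponent of the finite-dimensional distributions.\<close>

lemma emeasure_frechet_intensity_UN_greaterThan:
  assumes "finite I" and y: "\<And>i. i \<in> I \<Longrightarrow> 0 < y i"
  shows "emeasure frechet_intensity {p. 0 < p \<and> (\<exists>i\<in>I. 1 < p * y i)} = (SUP i\<in>I. ennreal (y i))"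
proof (cases "I = {}")
  case False
  then obtain m where m: "m \<in> I" "y m = Max (y ` I)"
    using assms(1) Max_in[of "y ` I"] by fastforce
  then have m: "m \<in> I" "\<And>i. i \<in> I \<Longrightarrow> y i \<le> y m"
    using assms(1) by auto
  then have ym: "0 < y m" using y by blast
  have "{p. 0 < p \<and> (\<exists>i\<in>I. 1 < p * y i)} = {1 / y m<..}"
  proof (intro set_eqI iffI; clarsimp)
    fix p i assume "0 < p" "i \<in> I" "1 < p * y i"
    moreover have "p * y i \<le> p * y m" using m \<open>i \<in> I\<close> \<open>0 < p\<close> by simp
    ultimately have "1 < p * y m" by linarith
    then show "1 / y m < p" using ym by (simp add: divide_less_eq)
  next
    fix p assume p: "1 / y m < p"
    then have "0 < p" using ym by (meson less_trans zero_less_divide_1_iff)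
    moreover have "1 < p * y m" using p ym by (simp add: divide_less_eq)
    ultimately show "0 < p \<and> (\<exists>i\<in>I. 1 < p * y i)" using m by blast
  qed
  then have "emeasure frechet_intensity {p. 0 < p \<and> (\<exists>i\<in>I. 1 < p * y i)} = ennreal (y m)"
    using ym by (simp add: emeasure_frechet_intensity_greaterThan)
  also have "\<dots> = (SUP i\<in>I. ennreal (y i))"
    using m by (intro antisym SUP_upper SUP_least ennreal_leI)
  finally show ?thesis .
qed (simp add: bot_ennreal)

lemma sigma_finite_frechet_intensity: "sigma_finite_measure frechet_intensity"
proof -
  interpret sigma_finite_measure "restrict_space lborel {0::real<..}"
    by (rule sigma_finite_measure_restrict_space) (auto intro: lborel.sigma_finite_measure_axioms)
  show ?thesis
    unfolding frechet_intensity_def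
    by (subst sigma_finite_iff_density_finite) (auto intro!: measurable_restrict_space1)
qed

section \<open>Measurability of paths and equality of laws\<close>

lemma measurable_path_component [measurable (raw)]:
  assumes "f \<in> N \<rightarrow>\<^sub>M path_borel"
  shows "(\<lambda>x. f x t) \<in> borel_measurable N"
  using measurable_compose[OF assms measurable_component_singleton[of t UNIV]] by simp

lemma measurable_pathI:
  assumes "\<And>t. (\<lambda>\<omega>. X t \<omega>) \<in> borel_measurable M"
  shows "(\<lambda>\<omega> t. X t \<omega>) \<in> M \<rightarrow>\<^sub>M path_borel"
  using assms by (intro measurable_PiM_single') auto

text \<open>Both probabilities are the mass of one event under the common law. This serves to
  replace a copy \<open>Wc i\<close> by \<open>W\<close>, and to shift \<xi> in time.\<close>

lemma prob_process_law_cong: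
  assumes "process_law M X = process_law M Y"
    and "\<And>t. X t \<in> borel_measurable M" "\<And>t. Y t \<in> borel_measurable M"
    and Q: "Measurable.pred path_borel Q"
  shows "measure M {\<omega>\<in>space M. Q (\<lambda>t. X t \<omega>)} = measure M {\<omega>\<in>space M. Q (\<lambda>t. Y t \<omega>)}"
proof -
  have *: "measure M {\<omega>\<in>space M. Q (\<lambda>t. X t \<omega>)} = measure (process_law M X) {w\<in>space path_borel. Q w}"
    if X: "\<And>t. X t \<in> borel_measurable M" for X
  proof -
    have "measure (process_law M X) {w\<in>space path_borel. Q w}
        = measure M ((\<lambda>\<omega> t. X t \<omega>) -` {w\<in>space path_borel. Q w} \<inter> space M)"
      unfolding process_law_def using predE[OF Q] by (rule measure_distr[OF measurable_pathI[OF X]])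
    also have "(\<lambda>\<omega> t. X t \<omega>) -` {w\<in>space path_borel. Q w} \<inter> space M = {\<omega>\<in>space M. Q (\<lambda>t. X t \<omega>)}"
      by (auto simp: space_PiM)
    finally show ?thesis by (rule sym)
  qed
  show ?thesis
    unfolding *[OF assms(2)] *[OF assms(3)] assms(1) by (rule refl)
qed

section \<open>The max-stable process and its spectral representation\<close>

text \<open>The normalization \<open>W_exp\<close> is stated as a nonnegative integral, so that it
  also carries the integrability of \<open>exp (W t)\<close>.\<close>

locale spectral_process = prob_space M for M :: "'a measure" +
  fixes W :: "real \<Rightarrow> 'a \<Rightarrow> real" and P :: "nat \<Rightarrow> 'a \<Rightarrow> real" and Wc :: "nat \<Rightarrow> real \<Rightarrow> 'a \<Rightarrow> real"
    and \<xi> :: "real \<Rightarrow> 'a \<Rightarrow> ennreal"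
  assumes W_measurable [measurable]: "\<And>t. W t \<in> borel_measurable M"
    and W_0: "AE \<omega> in M. W 0 \<omega> = 0"
    and W_exp: "\<And>t. (\<integral>\<^sup>+\<omega>. ennreal (exp (W t \<omega>)) \<partial>M) = 1"
    and poisson: "poisson_point_process M frechet_intensity P"
    and law_copies: "\<And>i. process_law M (Wc i) = process_law M W"
    and indep_copies: "indep_vars (\<lambda>_. path_borel) (\<lambda>i \<omega> t. Wc i t \<omega>) UNIV"
    and indep_poisson: "indep_rv M (\<Pi>\<^sub>M i\<in>UNIV. frechet_intensity) (\<lambda>\<omega> i. P i \<omega>)
                    (\<Pi>\<^sub>M i\<in>UNIV. path_borel) (\<lambda>\<omega> i t. Wc i t \<omega>)"
    and \<xi>_eq: "\<xi> = spectral_sup P Wc"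
begin

lemma P_measurable [measurable]: "P i \<in> borel_measurable M"
  and P_pos: "\<omega> \<in> space M \<Longrightarrow> 0 < P i \<omega>"
proof -
  have "P i \<in> M \<rightarrow>\<^sub>M frechet_intensity"
    using poisson unfolding poisson_point_process_def by auto
  from measurable_compose[OF this measurable_frechet_intensity_borel] measurable_space[OF this]
  show "P i \<in> borel_measurable M" "\<omega> \<in> space M \<Longrightarrow> 0 < P i \<omega>"
    by auto
qed

lemma Wc_measurable [measurable]: "Wc i t \<in> borel_measurable M"
proof -
  have "(\<lambda>\<omega> t. Wc i t \<omega>) \<in> M \<rightarrow>\<^sub>M path_borel"
    using indep_copies unfolding indep_vars_def by auto
  then show ?thesis by measurable
qed

lemma \<xi>_measurable [measurable]: "\<xi> t \<in> borel_measurable M"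
  unfolding \<xi>_eq spectral_sup_def[abs_def] by measurable

lemma \<xi>_le_iff:
  assumes "0 \<le> u"
  shows "\<xi> t \<omega> \<le> ennreal u \<longleftrightarrow> (\<forall>n. P n \<omega> * exp (Wc n t \<omega>) \<le> u)"
  using assms by (simp add: \<xi>_eq spectral_sup_def SUP_le_iff)

text \<open>A finite maximum is at most the sum, and each summand has mean \<open>1 / x i\<close>.
  Finiteness matters because the exponents are later converted to reals by
  \<open>enn2real\<close>.\<close>

lemma nn_integral_SUP_exp_finite:
  fixes \<tau> x :: "'i \<Rightarrow> real"
  assumes I: "finite I" and x: "\<And>i. i \<in> I \<Longrightarrow> 0 < x i"
  shows "(\<integral>\<^sup>+\<omega>. (SUP i\<in>I. ennreal (exp (W (\<tau> i) \<omega>) / x i)) \<partial>M) < \<infinity>"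
    (is "?Z < \<infinity>")
proof -
  have "?Z \<le> (\<integral>\<^sup>+\<omega>. (\<Sum>i\<in>I. ennreal (1 / x i) * ennreal (exp (W (\<tau> i) \<omega>))) \<partial>M)"
  proof (intro nn_integral_mono SUP_least)
    fix \<omega> i assume i: "i \<in> I"
    then have "ennreal (exp (W (\<tau> i) \<omega>) / x i) = ennreal (1 / x i) * ennreal (exp (W (\<tau> i) \<omega>))"
      using x by (subst ennreal_mult[symmetric]) (auto simp: less_imp_le)
    also have "\<dots> \<le> (\<Sum>i\<in>I. ennreal (1 / x i) * ennreal (exp (W (\<tau> i) \<omega>)))"
      using I i by (intro member_le_sum) auto
    finally show "ennreal (exp (W (\<tau> i) \<omega>) / x i) \<le> (\<Sum>i\<in>I. ennreal (1 / x i) * ennreal (exp (W (\<tau> i) \<omega>)))" .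
  qed
  also have "\<dots> = (\<Sum>i\<in>I. ennreal (1 / x i))"
    by (subst nn_integral_sum) (auto simp: nn_integral_cmult W_exp)
  also have "\<dots> < \<infinity>"
    using x by (subst sum_ennreal) (auto simp: less_imp_le)
  finally show ?thesis .
qed

text \<open>The event says that no point, taken together with its path, exceeds one of the levels.
  With the Poisson points frozen, the independent copies give the product of the factors
  \<open>1 - h (P i)\<close>; averaging over the points is the generating functional, and Fubini
  computes its exponent.\<close>

lemma prob_\<xi>_le:
  fixes \<tau> x :: "'i \<Rightarrow> real"
  assumes I: "finite I" and x: "\<And>i. i \<in> I \<Longrightarrow> 0 < x i"
  shows "prob {\<omega>\<in>space M. \<forall>i\<in>I. \<xi> (\<tau> i) \<omega> \<le> ennreal (x i)}
    = exp (- enn2real (\<integral>\<^sup>+\<omega>. (SUP i\<in>I. ennreal (exp (W (\<tau> i) \<omega>) / x i)) \<partial>M))"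
proof -
  have I_countable [measurable]: "countable I"
    using I by (rule countable_finite)
  define D where "D p w \<longleftrightarrow> (\<forall>i\<in>I. p * exp (w (\<tau> i)) \<le> x i)" for p :: real and w :: "real \<Rightarrow> real"
  have [measurable]: "Measurable.pred path_borel (D p)" for p
    unfolding D_def by measurable
  \<comment> \<open>The probability that a point at height \<open>p\<close> with a path distributed
    as \<open>W\<close> exceeds some level; the generating functional is applied to this
    function.\<close>
  define h where "h p = prob {\<omega>\<in>space M. \<not> D p (\<lambda>t. W t \<omega>)}" for p
  have W_path [measurable]: "(\<lambda>\<omega> t. W t \<omega>) \<in> M \<rightarrow>\<^sub>M path_borel"
    by (rule measurable_pathI) measurable
  have Wc_path [measurable]: "(\<lambda>\<omega> t. Wc i t \<omega>) \<in> M \<rightarrow>\<^sub>M path_borel" for i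
    by (rule measurable_pathI) measurable
  have g: "prob {\<omega>\<in>space M. D p (\<lambda>t. Wc i t \<omega>)} = 1 - h p" for p i
  proof -
    have "prob {\<omega>\<in>space M. D p (\<lambda>t. Wc i t \<omega>)} = prob {\<omega>\<in>space M. D p (\<lambda>t. W t \<omega>)}"
      by (rule prob_process_law_cong[OF law_copies]) measurable
    also have "\<dots> = 1 - h p"
      unfolding h_def by (subst prob_neg) auto
    finally show ?thesis .
  qed
  \<comment> \<open>The indicator of the same exceedance, as a jointly measurable function of the
    height and the outcome, so that Fubini applies to the integral of \<open>h\<close>.\<close>
  define F :: "real \<Rightarrow> 'a \<Rightarrow> ennreal"
    where "F p \<omega> = (if \<exists>i\<in>I. 1 < p * (exp (W (\<tau> i) \<omega>) / x i) then 1 else 0)" for p \<omega>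
  have [measurable]: "(\<lambda>(p, \<omega>). F p \<omega>) \<in> borel_measurable (frechet_intensity \<Otimes>\<^sub>M M)"
  proof -
    have [measurable]: "fst \<in> borel_measurable (frechet_intensity \<Otimes>\<^sub>M M)"
      using measurable_compose[OF measurable_fst[of frechet_intensity M] measurable_frechet_intensity_borel]
      by simp
    show ?thesis
      unfolding F_def split_beta' by measurable
  qed
  have D_F: "F p \<omega> = indicator {\<omega>\<in>space M. \<not> D p (\<lambda>t. W t \<omega>)} \<omega>" if "\<omega> \<in> space M" for p \<omega>
    using x that by (auto simp: F_def D_def indicator_def field_simps not_le)
  have h_F: "ennreal (h p) = (\<integral>\<^sup>+\<omega>. F p \<omega> \<partial>M)" for p
    by (simp add: D_F h_def emeasure_eq_measure cong: nn_integral_cong)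
  have h: "0 \<le> h p" "h p \<le> 1" for p
    by (auto simp: h_def)
  have [measurable]: "h \<in> borel_measurable frechet_intensity"
  proof -
    have "(\<lambda>p. enn2real (\<integral>\<^sup>+\<omega>. F p \<omega> \<partial>M)) \<in> borel_measurable frechet_intensity"
      by measurable
    then show ?thesis
      unfolding h_F[symmetric] by (simp add: h)
  qed
  interpret F: sigma_finite_measure frechet_intensity
    by (rule sigma_finite_frechet_intensity)
  interpret pair_sigma_finite frechet_intensity M ..
  let ?Z = "\<integral>\<^sup>+\<omega>. (SUP i\<in>I. ennreal (exp (W (\<tau> i) \<omega>) / x i)) \<partial>M"
  \<comment> \<open>After exchanging the integrals the path is fixed, and the inner integral is the
    intensity of a half-line.\<close>
  have int_h: "(\<integral>\<^sup>+p. ennreal (h p) \<partial>frechet_intensity) = ?Z"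
  proof -
    have "(\<integral>\<^sup>+p. ennreal (h p) \<partial>frechet_intensity) = (\<integral>\<^sup>+\<omega>. (\<integral>\<^sup>+p. F p \<omega> \<partial>frechet_intensity) \<partial>M)"
      unfolding h_F by (rule Fubini'[symmetric]) measurable
    also have "\<dots> = ?Z"
    proof (rule nn_integral_cong)
      fix \<omega> assume \<omega>: "\<omega> \<in> space M"
      let ?A = "{p. 0 < p \<and> (\<exists>i\<in>I. 1 < p * (exp (W (\<tau> i) \<omega>) / x i))}"
      have "?A \<in> sets frechet_intensity"
      proof -
        note [measurable] = measurable_frechet_intensity_borel
        have "{p\<in>space frechet_intensity. \<exists>i\<in>I. 1 < p * (exp (W (\<tau> i) \<omega>) / x i)} \<in> sets frechet_intensity"
          using I by measurable
        moreover have "?A = {p\<in>space frechet_intensity. \<exists>i\<in>I. 1 < p * (exp (W (\<tau> i) \<omega>) / x i)}"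
          by auto
        ultimately show ?thesis by metis
      qed
      moreover have "(\<integral>\<^sup>+p. F p \<omega> \<partial>frechet_intensity) = (\<integral>\<^sup>+p. indicator ?A p \<partial>frechet_intensity)"
        by (intro nn_integral_cong) (auto simp: F_def indicator_def)
      ultimately have "(\<integral>\<^sup>+p. F p \<omega> \<partial>frechet_intensity) = emeasure frechet_intensity ?A"
        by simp
      also have "\<dots> = (SUP i\<in>I. ennreal (exp (W (\<tau> i) \<omega>) / x i))"
        using I x by (intro emeasure_frechet_intensity_UN_greaterThan) auto
      finally show "(\<integral>\<^sup>+p. F p \<omega> \<partial>frechet_intensity) = (SUP i\<in>I. ennreal (exp (W (\<tau> i) \<omega>) / x i))" .
    qed
    finally show ?thesis .
  qed
  have Z: "?Z < \<infinity>"
    using I x by (rule nn_integral_SUP_exp_finite)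
  have "integrable frechet_intensity h"
    using Z by (intro integrableI_bounded) (auto simp: h int_h)
  moreover have "integral\<^sup>L frechet_intensity h = enn2real ?Z"
    by (subst integral_eq_nn_integral) (auto simp: h int_h)
  ultimately have pgf: "(\<integral>\<^sup>+\<omega>. (INF k. ennreal (\<Prod>i<k. 1 - h (P i \<omega>))) \<partial>M) = ennreal (exp (- enn2real ?Z))"
    using poisson_point_process_pgf[OF poisson, of h] h by simp
  \<comment> \<open>For deterministic heights \<open>p\<close>, independence of the copies gives the
    product over the first \<open>k\<close> indices, and continuity from above passes to all
    indices.\<close>
  have inner: "emeasure M {\<eta>\<in>space M. \<forall>n. D (p n) (\<lambda>t. Wc n t \<eta>)} = (INF k. ennreal (\<Prod>i<k. 1 - h (p i)))" for p
  proof -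
    let ?E = "\<lambda>n. {\<eta>\<in>space M. D (p n) (\<lambda>t. Wc n t \<eta>)}"
    let ?G = "\<lambda>k. {\<eta>\<in>space M. \<forall>n<k. D (p n) (\<lambda>t. Wc n t \<eta>)}"
    have prod: "prob (?G k) = (\<Prod>i<k. 1 - h (p i))" for k
    proof (cases "k = 0")
      case False
      have vi: "(\<lambda>\<omega> t. Wc i t \<omega>) -` {w\<in>space path_borel. D (p i) w} \<inter> space M = ?E i" for i
        by (auto simp: space_PiM)
      have G: "?G k = (\<Inter>i\<in>{..<k}. ?E i)"
        using False by auto
      have "prob (\<Inter>i\<in>{..<k}. (\<lambda>\<omega> t. Wc i t \<omega>) -` {w\<in>space path_borel. D (p i) w} \<inter> space M)
          = (\<Prod>i\<in>{..<k}. prob ((\<lambda>\<omega> t. Wc i t \<omega>) -` {w\<in>space path_borel. D (p i) w} \<inter> space M))"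
        using False by (intro indep_varsD[OF indep_copies]) auto
      then show ?thesis
        unfolding G vi g .
    qed (simp add: prob_space)
    have "emeasure M (\<Inter>k. ?G k) = (INF k. emeasure M (?G k))"
    proof (rule INF_emeasure_decseq[symmetric])
      show "range ?G \<subseteq> sets M"
        by (intro image_subsetI) measurable
      show "decseq ?G"
        by (intro antimonoI) auto
    qed simp
    moreover have "(\<Inter>k. ?G k) = {\<eta>\<in>space M. \<forall>n. D (p n) (\<lambda>t. Wc n t \<eta>)}"
      by auto
    ultimately show ?thesis
      by (simp add: emeasure_eq_measure prod)
  qed
  let ?S = "\<Pi>\<^sub>M i\<in>(UNIV::nat set). frechet_intensity"
  let ?T = "\<Pi>\<^sub>M i\<in>(UNIV::nat set). (path_borel :: (real \<Rightarrow> real) measure)"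
  \<comment> \<open>The event as a set of pairs of a height sequence and a path sequence, the form
    to which the independence of the two families applies.\<close>
  define A where "A = {z\<in>space (?S \<Otimes>\<^sub>M ?T). \<forall>n. D (fst z n) (snd z n)}"
  have A: "A \<in> sets (?S \<Otimes>\<^sub>M ?T)"
  proof -
    have f: "(\<lambda>z. fst z n) \<in> borel_measurable (?S \<Otimes>\<^sub>M ?T)" for n
      using measurable_compose[OF measurable_compose[OF measurable_fst[of ?S ?T]
          measurable_component_singleton[of n UNIV]] measurable_frechet_intensity_borel] by simp
    have "(\<lambda>z. snd z n) \<in> (?S \<Otimes>\<^sub>M ?T) \<rightarrow>\<^sub>M path_borel" for n
      using measurable_compose[OF measurable_snd[of ?S ?T] measurable_component_singleton[of n UNIV]] by simp
    from measurable_path_component[OF this]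
    have g: "(\<lambda>z. snd z n t) \<in> borel_measurable (?S \<Otimes>\<^sub>M ?T)" for n t .
    have "{z\<in>space (?S \<Otimes>\<^sub>M ?T). fst z n * exp (snd z n (\<tau> i)) \<le> x i} \<in> sets (?S \<Otimes>\<^sub>M ?T)" for n i
      by (rule borel_measurable_le[OF borel_measurable_times[OF f measurable_compose[OF g borel_measurable_exp]]
          measurable_const]) simp
    then have "{z\<in>space (?S \<Otimes>\<^sub>M ?T). \<forall>i\<in>I. fst z n * exp (snd z n (\<tau> i)) \<le> x i} \<in> sets (?S \<Otimes>\<^sub>M ?T)" for n
      using I by (rule sets.sets_Collect_finite_All)
    then show ?thesis
      unfolding A_def D_def by (rule sets.sets_Collect_countable_All)
  qed
  have in_A: "((\<lambda>i. P i \<omega>), (\<lambda>i t. Wc i t \<eta>)) \<in> A \<longleftrightarrow> (\<forall>n. D (P n \<omega>) (\<lambda>t. Wc n t \<eta>))"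
    if "\<omega> \<in> space M" for \<omega> \<eta>
    using that by (auto simp: A_def space_pair_measure space_PiM P_pos)
  have "{\<omega>\<in>space M. \<forall>i\<in>I. \<xi> (\<tau> i) \<omega> \<le> ennreal (x i)}
      = {\<omega>\<in>space M. ((\<lambda>i. P i \<omega>), (\<lambda>i t. Wc i t \<omega>)) \<in> A}"
    using x by (auto simp: in_A D_def \<xi>_le_iff less_imp_le)
  then have "emeasure M {\<omega>\<in>space M. \<forall>i\<in>I. \<xi> (\<tau> i) \<omega> \<le> ennreal (x i)}
      = (\<integral>\<^sup>+\<omega>. emeasure M {\<eta>\<in>space M. ((\<lambda>i. P i \<omega>), (\<lambda>i t. Wc i t \<eta>)) \<in> A} \<partial>M)"
    using indep_rv_emeasure[OF indep_poisson A] by simp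
  also have "\<dots> = (\<integral>\<^sup>+\<omega>. (INF k. ennreal (\<Prod>i<k. 1 - h (P i \<omega>))) \<partial>M)"
    by (rule nn_integral_cong) (simp add: in_A inner)
  also note pgf
  finally show ?thesis
    by (simp add: emeasure_eq_measure)
qed

end

subsection \<open>Clusters of exceedances\<close>

text \<open>Squeeze with \<open>y / (1 + y) \<le> 1 - exp (- y) \<le> y\<close> at
  \<open>y = c n / u n\<close>.\<close>

lemma scaled_one_minus_exp_tendsto:
  fixes u c :: "nat \<Rightarrow> real"
  assumes u: "filterlim u at_top sequentially" and c: "c \<longlonglongrightarrow> l" "\<And>n. 0 \<le> c n"
  shows "(\<lambda>n. u n * (1 - exp (- (c n / u n)))) \<longlonglongrightarrow> l"
proof (rule tendsto_sandwich)
  have pos: "\<forall>\<^sub>F n in sequentially. 0 < u n"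
    using u by (auto simp: filterlim_at_top_dense)
  have "1 - exp (- y) \<le> y" "y / (1 + y) \<le> 1 - exp (- y)" if "0 \<le> y" for y :: real
  proof -
    show "1 - exp (- y) \<le> y"
      using exp_ge_add_one_self[of "- y"] by simp
    have "exp (- y) \<le> 1 / (1 + y)"
      using exp_ge_add_one_self[of y] that by (simp add: exp_minus field_simps)
    then show "y / (1 + y) \<le> 1 - exp (- y)"
      using that by (simp add: field_simps)
  qed
  note bounds = this
  show "\<forall>\<^sub>F n in sequentially. c n / (1 + c n / u n) \<le> u n * (1 - exp (- (c n / u n)))"
    using pos
  proof eventually_elim
    case (elim n)
    have "c n / (1 + c n / u n) = u n * ((c n / u n) / (1 + c n / u n))"
      using elim by simp
    also have "\<dots> \<le> u n * (1 - exp (- (c n / u n)))"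
      using elim c(2)[of n] by (intro mult_left_mono bounds) auto
    finally show ?case .
  qed
  show "\<forall>\<^sub>F n in sequentially. u n * (1 - exp (- (c n / u n))) \<le> c n"
    using pos
  proof eventually_elim
    case (elim n)
    have "u n * (1 - exp (- (c n / u n))) \<le> u n * (c n / u n)"
      using elim c(2)[of n] by (intro mult_left_mono bounds) auto
    then show ?case using elim by simp
  qed
  have "(\<lambda>n. c n / u n) \<longlonglongrightarrow> 0"
    by (rule real_tendsto_divide_at_top[OF c(1) u])
  then have "(\<lambda>n. c n / (1 + c n / u n)) \<longlonglongrightarrow> l / (1 + 0)"
    by (intro tendsto_intros c(1)) auto
  then show "(\<lambda>n. c n / (1 + c n / u n)) \<longlonglongrightarrow> l" by simp
qed (rule c(1))

text \<open>The expression is the conditional exceedance probability at level \<open>u n\<close>.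
  Numerator and denominator of the fraction are both of order \<open>1 / u n\<close>, so both are
  multiplied by \<open>u n\<close>; the exponential prefactor tends to 1 because
  \<open>a n / u n\<close> vanishes.\<close>

lemma exp_cluster_ratio_tendsto:
  fixes u a q :: "nat \<Rightarrow> real"
  assumes u: "filterlim u at_top sequentially" and a: "(\<lambda>n. a n / u n) \<longlonglongrightarrow> 0"
    and q: "q \<longlonglongrightarrow> l" "\<And>n. q n \<le> 1"
  shows "(\<lambda>n. 1 - exp (- (a n / u n)) * (1 - exp (- ((1 - q n) / u n))) / (1 - exp (- (1 / u n)))) \<longlonglongrightarrow> l"
proof -
  have num: "(\<lambda>n. u n * (1 - exp (- ((1 - q n) / u n)))) \<longlonglongrightarrow> 1 - l"
    using q by (intro scaled_one_minus_exp_tendsto u tendsto_intros) auto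
  have den: "(\<lambda>n. u n * (1 - exp (- (1 / u n)))) \<longlonglongrightarrow> 1"
    by (intro scaled_one_minus_exp_tendsto u tendsto_intros) auto
  have "(\<lambda>n. 1 - exp (- (a n / u n)) * ((u n * (1 - exp (- ((1 - q n) / u n)))) / (u n * (1 - exp (- (1 / u n))))))
      \<longlonglongrightarrow> 1 - exp (- 0) * ((1 - l) / 1)" (is "?f \<longlonglongrightarrow> _")
    by (intro tendsto_intros a num den) auto
  then have "?f \<longlonglongrightarrow> l" by (simp only: minus_zero exp_zero mult_1 div_by_1) simp
  moreover have "\<forall>\<^sub>F n in sequentially. 0 < u n"
    using u by (auto simp: filterlim_at_top_dense)
  then have "\<forall>\<^sub>F n in sequentially.
      1 - exp (- (a n / u n)) * ((u n * (1 - exp (- ((1 - q n) / u n)))) / (u n * (1 - exp (- (1 / u n)))))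
    = 1 - exp (- (a n / u n)) * (1 - exp (- ((1 - q n) / u n))) / (1 - exp (- (1 / u n)))"
    by eventually_elim simp
  ultimately show ?thesis
    by (rule Lim_transform_eventually)
qed

text \<open>Rewrites divergence to minus infinity as the vanishing of a decreasing limit of
  functions bounded by 1. Almost sure divergence then becomes a statement about a limit of
  expectations.\<close>

lemma filterlim_at_bot_iff_INF_SUP_exp:
  fixes w :: "int \<Rightarrow> real"
  shows "filterlim w at_bot (filtercomap abs at_top)
    \<longleftrightarrow> (INF m::nat. min 1 (SUP k\<in>{k. int m \<le> \<bar>k\<bar>}. ennreal (exp (w k)))) = 0"
proof
  assume lim: "filterlim w at_bot (filtercomap abs at_top)"
  have "(INF m::nat. min 1 (SUP k\<in>{k. int m \<le> \<bar>k\<bar>}. ennreal (exp (w k)))) \<le> 0"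
  proof (rule ennreal_le_epsilon)
    fix e :: real assume "0 < e"
    have "eventually (\<lambda>k. w k \<le> ln e) (filtercomap abs at_top)"
      using lim by (auto simp: filterlim_at_bot)
    then obtain N where N: "\<And>k. N \<le> \<bar>k\<bar> \<Longrightarrow> w k \<le> ln e"
      unfolding eventually_filtercomap eventually_at_top_linorder by blast
    have "(INF m::nat. min 1 (SUP k\<in>{k. int m \<le> \<bar>k\<bar>}. ennreal (exp (w k))))
        \<le> min 1 (SUP k\<in>{k. int (nat N) \<le> \<bar>k\<bar>}. ennreal (exp (w k)))"
      by (rule INF_lower) simp
    also have "\<dots> \<le> (SUP k\<in>{k. int (nat N) \<le> \<bar>k\<bar>}. ennreal (exp (w k)))"
      by (rule min.cobounded2)
    also have "\<dots> \<le> ennreal e"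
    proof (rule SUP_least)
      fix k :: int assume "k \<in> {k. int (nat N) \<le> \<bar>k\<bar>}"
      then have "w k \<le> ln e" by (intro N) (simp split: if_splits)
      then show "ennreal (exp (w k)) \<le> ennreal e"
        using \<open>0 < e\<close> by (metis ennreal_leI exp_le_cancel_iff exp_ln)
    qed
    finally show "(INF m::nat. min 1 (SUP k\<in>{k. int m \<le> \<bar>k\<bar>}. ennreal (exp (w k)))) \<le> 0 + ennreal e"
      by simp
  qed
  then show "(INF m::nat. min 1 (SUP k\<in>{k. int m \<le> \<bar>k\<bar>}. ennreal (exp (w k)))) = 0"
    by simp
next
  assume eq: "(INF m::nat. min 1 (SUP k\<in>{k. int m \<le> \<bar>k\<bar>}. ennreal (exp (w k)))) = 0"
  show "filterlim w at_bot (filtercomap abs at_top)"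
    unfolding filterlim_at_bot
  proof
    fix C :: real
    \<comment> \<open>The level is at most 1, so it must be the supremum, and not the truncation,
      that falls below it.\<close>
    have "(INF m::nat. min 1 (SUP k\<in>{k. int m \<le> \<bar>k\<bar>}. ennreal (exp (w k)))) < ennreal (min 1 (exp C))"
      unfolding eq by (simp add: ennreal_zero_less_one)
    then obtain m :: nat where "min 1 (SUP k\<in>{k. int m \<le> \<bar>k\<bar>}. ennreal (exp (w k))) < ennreal (min 1 (exp C))"
      by (auto simp: INF_less_iff)
    then have m: "(SUP k\<in>{k. int m \<le> \<bar>k\<bar>}. ennreal (exp (w k))) < ennreal (min 1 (exp C))"
      by (auto simp: min_def split: if_splits)
    have "w k \<le> C" if "int m \<le> \<bar>k\<bar>" for k
    proof -
      have "ennreal (exp (w k)) \<le> (SUP k\<in>{k. int m \<le> \<bar>k\<bar>}. ennreal (exp (w k)))"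
        using that by (intro SUP_upper) simp
      also note m
      also have "ennreal (min 1 (exp C)) \<le> ennreal (exp C)"
        by (intro ennreal_leI) simp
      finally show ?thesis by (simp add: ennreal_less_iff)
    qed
    then show "\<forall>\<^sub>F k in filtercomap abs at_top. w k \<le> C"
      unfolding eventually_filtercomap eventually_at_top_linorder by blast
  qed
qed

section \<open>Restriction to the lattice and conditional exceedance probabilities\<close>

locale lattice_spectral_process = spectral_process +
  fixes \<delta> :: real
begin

definition X :: "int \<Rightarrow> 'a \<Rightarrow> ennreal" where
  "X k \<omega> = ennreal (exp (W (of_int k * \<delta>) \<omega>))"

lemma X_measurable [measurable]: "X k \<in> borel_measurable M"
  unfolding X_def[abs_def] by measurable

lemma X_pos [simp]: "0 < X k \<omega>"
  by (simp add: X_def)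

lemma X_less_top [simp]: "X k \<omega> < top"
  by (simp add: X_def)

lemma X_0: "AE \<omega> in M. X 0 \<omega> = 1"
  using W_0 by eventually_elim (simp add: X_def)

lemma nn_integral_X: "(\<integral>\<^sup>+\<omega>. X k \<omega> \<partial>M) = 1"
  unfolding X_def by (rule W_exp)

lemma SUP_X_measurable [measurable]: "(\<lambda>\<omega>. SUP k\<in>K. X k \<omega>) \<in> borel_measurable M"
  by (intro borel_measurable_SUP) auto

definition mean_sup :: "int set \<Rightarrow> ennreal" where
  "mean_sup K = (\<integral>\<^sup>+\<omega>. (SUP k\<in>K. X k \<omega>) \<partial>M)"

text \<open>Truncation at 1 keeps this finite for infinite index sets. It enters through
  inclusion-exclusion with the index \<open>0\<close>, where the process equals 1.\<close>

definition mean_sup_1 :: "int set \<Rightarrow> ennreal" where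
  "mean_sup_1 K = (\<integral>\<^sup>+\<omega>. min 1 (SUP k\<in>K. X k \<omega>) \<partial>M)"

lemma mean_sup_le_card:
  assumes "finite K"
  shows "mean_sup K \<le> of_nat (card K)"
proof -
  have "mean_sup K \<le> (\<integral>\<^sup>+\<omega>. (\<Sum>k\<in>K. X k \<omega>) \<partial>M)"
    unfolding mean_sup_def using assms by (intro nn_integral_mono SUP_least member_le_sum) auto
  also have "\<dots> = (\<Sum>k\<in>K. 1)"
    by (subst nn_integral_sum) (auto simp: nn_integral_X)
  finally show ?thesis by simp
qed

lemma mean_sup_less_top:
  assumes "finite K"
  shows "mean_sup K < top"
  using mean_sup_le_card[OF assms] of_nat_less_top le_less_trans by blast

lemma mean_sup_1_le: "mean_sup_1 K \<le> 1"
proof -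
  have "mean_sup_1 K \<le> (\<integral>\<^sup>+\<omega>. 1 \<partial>M)"
    unfolding mean_sup_1_def by (intro nn_integral_mono) simp
  then show ?thesis by (simp add: emeasure_space_1)
qed

text \<open>Since \<open>X 0 = 1\<close> almost surely, this is the identity
  \<open>max 1 s + min 1 s = s + 1\<close>, integrated. The additive form avoids truncated
  subtraction.\<close>

lemma mean_sup_insert_0:
  "mean_sup (insert 0 K) + mean_sup_1 K = mean_sup K + 1"
proof -
  have "mean_sup (insert 0 K) + mean_sup_1 K = (\<integral>\<^sup>+\<omega>. (SUP k\<in>insert 0 K. X k \<omega>) + min 1 (SUP k\<in>K. X k \<omega>) \<partial>M)"
    unfolding mean_sup_def mean_sup_1_def by (rule nn_integral_add[symmetric]) measurable
  also have "\<dots> = (\<integral>\<^sup>+\<omega>. (SUP k\<in>K. X k \<omega>) + 1 \<partial>M)"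
    using X_0 by (intro nn_integral_cong_AE, eventually_elim)
      (auto simp: sup_max min_def max_def add.commute)
  also have "\<dots> = mean_sup K + 1"
    unfolding mean_sup_def by (subst nn_integral_add) (auto simp: emeasure_space_1)
  finally show ?thesis .
qed

lemma mean_sup_1_UN_incseq:
  assumes "incseq K"
  shows "(\<lambda>n. mean_sup_1 (K n)) \<longlonglongrightarrow> mean_sup_1 (\<Union>n. K n)"
proof -
  have S: "min 1 (SUP k\<in>(\<Union>n. K n). X k \<omega>) = (SUP n. min 1 (SUP k\<in>K n. X k \<omega>))" for \<omega>
    unfolding SUP_UNION by (simp add: inf_min[symmetric] inf_SUP)
  have mono: "incseq (\<lambda>n \<omega>. min 1 (SUP k\<in>K n. X k \<omega>))"
    using assms by (intro monoI le_funI min.mono SUP_subset_mono) (auto simp: mono_def)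
  have "mean_sup_1 (\<Union>n. K n) = (SUP n. mean_sup_1 (K n))"
    unfolding mean_sup_1_def S using mono by (rule nn_integral_monotone_convergence_SUP) measurable
  moreover have "incseq (\<lambda>n. mean_sup_1 (K n))"
    unfolding mean_sup_1_def by (intro monoI nn_integral_mono le_funD[OF monoD[OF mono]])
  ultimately show ?thesis
    using LIMSEQ_SUP by metis
qed

lemma prob_\<xi>_lattice_le:
  assumes "finite K" "0 < u"
  shows "prob {\<omega>\<in>space M. \<forall>k\<in>K. \<xi> (of_int k * \<delta>) \<omega> \<le> ennreal u} = exp (- (enn2real (mean_sup K) / u))"
proof -
  have "(\<integral>\<^sup>+\<omega>. (SUP k\<in>K. ennreal (exp (W (of_int k * \<delta>) \<omega>) / u)) \<partial>M)
      = (\<integral>\<^sup>+\<omega>. (SUP k\<in>K. X k \<omega>) * ennreal (1 / u) \<partial>M)"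
    using assms by (intro nn_integral_cong)
      (simp add: X_def SUP_mult_right_ennreal ennreal_mult[symmetric])
  also have "\<dots> = mean_sup K * ennreal (1 / u)"
    unfolding mean_sup_def by (rule nn_integral_multc) measurable
  finally show ?thesis
    using prob_\<xi>_le[of K "\<lambda>_. u" "\<lambda>k. of_int k * \<delta>"] assms by (simp add: enn2real_mult)
qed

text \<open>Inclusion-exclusion: both exceedances fail to occur together on the union of "no
  exceedance on \<open>K\<close>" and "no exceedance at \<open>0\<close>", whose intersection is "no
  exceedance on \<open>insert 0 K\<close>". The three probabilities are explicit
  exponentials.\<close>

lemma cond_prob_exceedance:
  assumes "finite K" "0 < u"
  shows "\<P>(\<omega> in M. (SUP k\<in>K. \<xi> (of_int k * \<delta>) \<omega>) > ennreal u \<bar> \<xi> 0 \<omega> > ennreal u)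
    = 1 - exp (- (enn2real (mean_sup K) / u)) * (1 - exp (- ((1 - enn2real (mean_sup_1 K)) / u))) / (1 - exp (- (1 / u)))"
proof -
  define A where "A K = {\<omega>\<in>space M. \<forall>k\<in>K. \<xi> (of_int k * \<delta>) \<omega> \<le> ennreal u}" for K
  define p where "p K = exp (- (enn2real (mean_sup K) / u))" for K
  have [measurable]: "A K \<in> sets M" if "finite K" for K
    unfolding A_def using that by (intro sets.sets_Collect_finite_All) measurable
  have pA: "prob (A K) = p K" if "finite K" for K
    unfolding A_def p_def using that assms(2) by (rule prob_\<xi>_lattice_le)
  have m0: "mean_sup {0} = 1"
    by (simp add: mean_sup_def nn_integral_X)
  have Int: "A K \<inter> A {0} = A (insert 0 K)"
    by (auto simp: A_def)
  have "{\<omega>\<in>space M. ennreal u < (SUP k\<in>K. \<xi> (of_int k * \<delta>) \<omega>) \<and> ennreal u < \<xi> 0 \<omega>} = space M - (A K \<union> A {0})"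
    by (auto simp: A_def less_SUP_iff not_le)
  moreover have "prob (space M - (A K \<union> A {0})) = 1 - (p K + p {0} - p (insert 0 K))"
    using assms(1) by (subst prob_compl) (auto simp: measure_Un3 fmeasurable_eq_sets pA Int)
  ultimately have num: "\<P>(\<omega> in M. ennreal u < (SUP k\<in>K. \<xi> (of_int k * \<delta>) \<omega>) \<and> ennreal u < \<xi> 0 \<omega>)
      = 1 - (p K + p {0} - p (insert 0 K))"
    by simp
  have "{\<omega>\<in>space M. ennreal u < \<xi> 0 \<omega>} = space M - A {0}"
    by (auto simp: A_def not_le)
  then have den: "\<P>(\<omega> in M. ennreal u < \<xi> 0 \<omega>) = 1 - p {0}"
    using prob_compl[of "A {0}"] by (simp add: pA)
  have "enn2real (mean_sup (insert 0 K) + mean_sup_1 K) = enn2real (mean_sup K + 1)"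
    by (simp add: mean_sup_insert_0)
  then have "enn2real (mean_sup (insert 0 K)) = enn2real (mean_sup K) + (1 - enn2real (mean_sup_1 K))"
    using assms(1) mean_sup_less_top[of K] mean_sup_less_top[of "insert 0 K"]
      le_less_trans[OF mean_sup_1_le[of K], of top] by (simp add: enn2real_plus)
  then have ins: "p (insert 0 K) = p K * exp (- ((1 - enn2real (mean_sup_1 K)) / u))"
    unfolding p_def by (simp add: exp_add[symmetric] add_divide_distrib diff_divide_distrib)
  have p0: "p {0} = exp (- (1 / u))" "p {0} \<noteq> 1"
    using assms(2) by (simp_all add: p_def m0)
  show ?thesis
    using p0 unfolding cond_prob_def num den ins p_def[symmetric] p0(1)[symmetric]
    by (simp add: field_simps)
qed

text \<open>The window has at most \<open>2 * r n + 1\<close> indices and each contributes mean 1,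
  so its mean supremum is negligible against \<open>real n * x\<close>. The limit involves neither
  \<open>x\<close> nor the choice of \<open>r\<close>.\<close>

lemma cond_prob_cluster_tendsto:
  assumes r: "filterlim r at_top sequentially" "(\<lambda>n. real (r n) / real n) \<longlonglongrightarrow> 0" and x: "0 < x"
  shows "(\<lambda>n. \<P>(\<omega> in M. (SUP k\<in>{k::int. int m \<le> \<bar>k\<bar> \<and> \<bar>k\<bar> \<le> int (r n)}. \<xi> (of_int k * \<delta>) \<omega>)
                               > ennreal (real n * x) \<bar> \<xi> 0 \<omega> > ennreal (real n * x)))
    \<longlonglongrightarrow> enn2real (mean_sup_1 {k. int m \<le> \<bar>k\<bar>})"
proof -
  define K where "K n = {k::int. int m \<le> \<bar>k\<bar> \<and> \<bar>k\<bar> \<le> int n}" for n :: nat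
  have KI: "K n \<subseteq> {- int n..int n}" for n
    by (auto simp: K_def)
  then have fin: "finite (K n)" for n
    by (rule finite_subset) simp
  have card: "card (K n) \<le> 2 * n + 1" for n
    using card_mono[OF _ KI[of n]] by simp
  have u: "filterlim (\<lambda>n. real n * x) at_top sequentially"
    using x by (intro filterlim_at_top_mult_tendsto_pos[OF tendsto_const]) (auto simp: filterlim_real_sequentially mult.commute)
  have "incseq K"
    by (intro monoI) (auto simp: K_def)
  moreover have "(\<Union>n. K n) = {k. int m \<le> \<bar>k\<bar>}"
    by (auto simp: K_def intro!: exI[of _ "nat \<bar>_\<bar>"])
  ultimately have "(\<lambda>n. mean_sup_1 (K n)) \<longlonglongrightarrow> mean_sup_1 {k. int m \<le> \<bar>k\<bar>}"
    using mean_sup_1_UN_incseq by metis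
  then have "(\<lambda>n. enn2real (mean_sup_1 (K n))) \<longlonglongrightarrow> enn2real (mean_sup_1 {k. int m \<le> \<bar>k\<bar>})"
    using le_less_trans[OF mean_sup_1_le, of top] by (intro tendsto_enn2real) auto
  then have q: "(\<lambda>n. enn2real (mean_sup_1 (K (r n)))) \<longlonglongrightarrow> enn2real (mean_sup_1 {k. int m \<le> \<bar>k\<bar>})"
    using r(1) by (rule filterlim_compose)
  have q1: "enn2real (mean_sup_1 (K n)) \<le> 1" for n
    using enn2real_mono[OF mean_sup_1_le[of "K n"]] by simp
  have a: "(\<lambda>n. enn2real (mean_sup (K (r n))) / (real n * x)) \<longlonglongrightarrow> 0"
  proof (rule tendsto_sandwich)
    show "\<forall>\<^sub>F n in sequentially. 0 \<le> enn2real (mean_sup (K (r n))) / (real n * x)"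
      using x by simp
    have "enn2real (mean_sup (K n)) \<le> 2 * real n + 1" for n
    proof -
      have "enn2real (mean_sup (K n)) \<le> enn2real (of_nat (card (K n)))"
        by (intro enn2real_mono mean_sup_le_card fin) (simp add: of_nat_less_top)
      also have "\<dots> \<le> 2 * real n + 1"
        using card[of n] by simp
      finally show ?thesis .
    qed
    then have "enn2real (mean_sup (K (r n))) / (real n * x) \<le> (2 * real (r n) + 1) / (real n * x)" for n
      using x by (intro divide_right_mono) auto
    then show "\<forall>\<^sub>F n in sequentially. enn2real (mean_sup (K (r n))) / (real n * x)
        \<le> 2 / x * (real (r n) / real n) + 1 / x * (1 / real n)"
      by (simp add: add_divide_distrib mult.commute)
    have "(\<lambda>n. 2 / x * (real (r n) / real n) + 1 / x * (1 / real n)) \<longlonglongrightarrow> 2 / x * 0 + 1 / x * 0"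
      by (intro tendsto_intros r(2) lim_1_over_n)
    then show "(\<lambda>n. 2 / x * (real (r n) / real n) + 1 / x * (1 / real n)) \<longlonglongrightarrow> 0"
      by simp
  qed simp
  have "\<forall>\<^sub>F n in sequentially. 0 < real n * x"
    using u unfolding filterlim_at_top_dense by blast
  then have "\<forall>\<^sub>F n in sequentially.
      1 - exp (- (enn2real (mean_sup (K (r n))) / (real n * x)))
        * (1 - exp (- ((1 - enn2real (mean_sup_1 (K (r n)))) / (real n * x)))) / (1 - exp (- (1 / (real n * x))))
    = \<P>(\<omega> in M. (SUP k\<in>K (r n). \<xi> (of_int k * \<delta>) \<omega>) > ennreal (real n * x) \<bar> \<xi> 0 \<omega> > ennreal (real n * x))"
    by eventually_elim (rule cond_prob_exceedance[OF fin, symmetric])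
  then show ?thesis
    using exp_cluster_ratio_tendsto[OF u a q q1] unfolding K_def[symmetric] by (rule Lim_transform_eventually[rotated])
qed

text \<open>Because the inner limit is the same for all admissible \<open>r\<close> and all
  \<open>x\<close>, testing at \<open>x = 1\<close> suffices in one direction, and a single
  admissible sequence suffices in the other.\<close>

lemma finite_mean_cluster_size_iff_tendsto:
  "finite_mean_cluster_size M \<xi> \<delta> \<longleftrightarrow> (\<lambda>m::nat. mean_sup_1 {k. int m \<le> \<bar>k\<bar>}) \<longlonglongrightarrow> 0"
proof -
  let ?p = "\<lambda>m n R x. \<P>(\<omega> in M. (SUP k\<in>{k::int. int m \<le> \<bar>k\<bar> \<and> \<bar>k\<bar> \<le> int R}. \<xi> (of_int k * \<delta>) \<omega>)
                               > ennreal (real n * x) \<bar> \<xi> 0 \<omega> > ennreal (real n * x))"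
  let ?q = "\<lambda>m::nat. mean_sup_1 {k. int m \<le> \<bar>k\<bar>}"
  have lim: "(\<lambda>m. limsup (\<lambda>n. ereal (?p m n (r n) x))) = (\<lambda>m. ereal (enn2real (?q m)))"
    if "filterlim r at_top sequentially" "(\<lambda>n. real (r n) / real n) \<longlonglongrightarrow> 0" "0 < x" for r :: "nat \<Rightarrow> nat" and x
    using cond_prob_cluster_tendsto[OF that] by (intro ext lim_imp_Limsup) auto
  have q: "?q m < top" for m
    using le_less_trans[OF mean_sup_1_le, of top] by simp
  have iff: "(\<lambda>m. ereal (enn2real (?q m))) \<longlonglongrightarrow> 0 \<longleftrightarrow> ?q \<longlonglongrightarrow> 0"
  proof -
    have "(\<lambda>m. ereal (enn2real (?q m))) \<longlonglongrightarrow> 0 \<longleftrightarrow> (\<lambda>m. enn2real (?q m)) \<longlonglongrightarrow> 0"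
      by (simp add: zero_ereal_def)
    also have "\<dots> \<longleftrightarrow> ?q \<longlonglongrightarrow> 0"
      using tendsto_ennrealI[of "\<lambda>m. enn2real (?q m)" 0] tendsto_enn2real[of ?q 0] q by auto
    finally show ?thesis .
  qed
  \<comment> \<open>An explicit admissible window: of the order of the square root of
    \<open>n\<close>, with the added 1 making it positive at \<open>n = 0\<close>.\<close>
  define s where "s n = nat \<lfloor>sqrt (real n)\<rfloor> + 1" for n
  have s: "filterlim s at_top sequentially" "(\<lambda>n. real (s n) / real n) \<longlonglongrightarrow> 0" "\<And>n. s n > 0"
  proof -
    have "filterlim (\<lambda>n. nat \<lfloor>sqrt (real n)\<rfloor>) at_top sequentially"
      by (intro filterlim_compose[OF filterlim_nat_sequentially] filterlim_compose[OF filterlim_floor_sequentially]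
          filterlim_compose[OF sqrt_at_top] filterlim_real_sequentially)
    then show "filterlim s at_top sequentially"
      unfolding s_def by (rule filterlim_at_top_mono) simp
    have "(\<lambda>n. real (s n) / real n) \<longlonglongrightarrow> 0"
    proof (rule tendsto_sandwich[OF _ _ tendsto_const])
      show "\<forall>\<^sub>F n in sequentially. real (s n) / real n \<le> 1 / sqrt (real n) + 1 / real n"
        using eventually_gt_at_top[of 0]
      proof eventually_elim
        case (elim n)
        have "real (s n) \<le> sqrt (real n) + 1"
          unfolding s_def by simp
        then have "real (s n) / real n \<le> (sqrt (real n) + 1) / real n"
          by (rule divide_right_mono) simp
        also have "\<dots> = 1 / sqrt (real n) + 1 / real n"
          by (simp add: add_divide_distrib sqrt_divide_self_eq inverse_eq_divide)
        finally show ?case .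
      qed
      have "(\<lambda>n. 1 / sqrt (real n)) \<longlonglongrightarrow> 0"
        by (intro tendsto_divide_0[OF tendsto_const] filterlim_at_top_imp_at_infinity
            filterlim_compose[OF sqrt_at_top] filterlim_real_sequentially)
      from tendsto_add[OF this lim_1_over_n]
      show "(\<lambda>n. 1 / sqrt (real n) + 1 / real n) \<longlonglongrightarrow> 0" by simp
    qed auto
    then show "(\<lambda>n. real (s n) / real n) \<longlonglongrightarrow> 0" .
  qed (simp add: s_def)
  show ?thesis
  proof
    assume "finite_mean_cluster_size M \<xi> \<delta>"
    then obtain r where "filterlim r at_top sequentially" "(\<lambda>n. real (r n) / real n) \<longlonglongrightarrow> 0"
      "(\<lambda>m. limsup (\<lambda>n. ereal (?p m n (r n) 1))) \<longlonglongrightarrow> 0"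
      unfolding finite_mean_cluster_size_def using zero_less_one by blast
    then show "?q \<longlonglongrightarrow> 0"
      using lim[of r 1] iff by simp
  next
    assume "?q \<longlonglongrightarrow> 0"
    then show "finite_mean_cluster_size M \<xi> \<delta>"
      unfolding finite_mean_cluster_size_def using s lim[of s] iff by (intro exI[of _ s]) simp
  qed
qed

text \<open>The truncated tail suprema decrease and are bounded by 1, so their expectations tend to
  the expectation of the infimum; this is zero exactly if the infimum vanishes almost
  surely.\<close>

lemma finite_mean_cluster_size_iff_dissipative:
  "finite_mean_cluster_size M \<xi> \<delta>
    \<longleftrightarrow> (AE \<omega> in M. filterlim (\<lambda>k::int. W (of_int k * \<delta>) \<omega>) at_bot (filtercomap abs at_top))"
proof -
  define Y where "Y m \<omega> = min 1 (SUP k\<in>{k. int m \<le> \<bar>k\<bar>}. X k \<omega>)" for m :: nat and \<omega>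
  have [measurable]: "Y m \<in> borel_measurable M" for m
    unfolding Y_def[abs_def] by measurable
  have dec: "decseq Y"
    unfolding Y_def by (intro antimonoI le_funI min.mono SUP_subset_mono) auto
  have Y_int: "integral\<^sup>N M (Y m) = mean_sup_1 {k. int m \<le> \<bar>k\<bar>}" for m
    unfolding Y_def mean_sup_1_def ..
  have "(\<integral>\<^sup>+\<omega>. (INF m. Y m \<omega>) \<partial>M) = (INF m. integral\<^sup>N M (Y m))"
    using le_less_trans[OF mean_sup_1_le, of top]
    by (intro nn_integral_monotone_convergence_INF_decseq[OF dec, of M 0]) (auto simp: Y_int)
  moreover have decI: "decseq (\<lambda>m. integral\<^sup>N M (Y m))"
    by (intro antimonoI nn_integral_mono le_funD[OF antimonoD[OF dec]])
  moreover have "(\<lambda>m. integral\<^sup>N M (Y m)) \<longlonglongrightarrow> 0 \<longleftrightarrow> (INF m. integral\<^sup>N M (Y m)) = 0"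
    using LIMSEQ_INF[OF decI] LIMSEQ_unique by metis
  moreover have "(\<integral>\<^sup>+\<omega>. (INF m. Y m \<omega>) \<partial>M) = 0 \<longleftrightarrow> (AE \<omega> in M. (INF m. Y m \<omega>) = 0)"
    by (rule nn_integral_0_iff_AE) measurable
  ultimately show ?thesis
    unfolding finite_mean_cluster_size_iff_tendsto filterlim_at_bot_iff_INF_SUP_exp
    by (simp add: Y_int Y_def X_def)
qed

end

subsection \<open>Change of measure\<close>

text \<open>The right derivative of \<open>s \<mapsto> E max (s x) y\<close> at
  \<open>s = 1\<close>. The difference quotients lie between 0 and \<open>x\<close>, so dominated
  convergence applies; approaching from the right makes ties \<open>y = x\<close> count, hence the
  non-strict inequality in the indicator.\<close>

lemma max_scaled_integral_tendsto:
  fixes x y :: "'a \<Rightarrow> real"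
  assumes x: "integrable M x" "\<And>\<omega>. 0 \<le> x \<omega>" and y: "integrable M y"
  shows "(\<lambda>n. real (Suc n) * ((\<integral>\<omega>. max ((1 + 1 / real (Suc n)) * x \<omega>) (y \<omega>) \<partial>M) - (\<integral>\<omega>. max (x \<omega>) (y \<omega>) \<partial>M)))
    \<longlonglongrightarrow> (\<integral>\<omega>. x \<omega> * indicator {\<omega>. y \<omega> \<le> x \<omega>} \<omega> \<partial>M)"
proof -
  have [measurable]: "x \<in> borel_measurable M" "y \<in> borel_measurable M"
    using x y by auto
  define f where "f n \<omega> = real (Suc n) * (max ((1 + 1 / real (Suc n)) * x \<omega>) (y \<omega>) - max (x \<omega>) (y \<omega>))" for n \<omega>
  have f: "0 \<le> f n \<omega>" "f n \<omega> \<le> x \<omega>" for n \<omega>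
  proof -
    define e where "e = 1 / real (Suc n)"
    have e: "0 < e" "real (Suc n) = 1 / e" by (auto simp: e_def)
    have ex: "0 \<le> e * x \<omega>" using e x(2)[of \<omega>] by simp
    then show "0 \<le> f n \<omega>"
      unfolding f_def e_def[symmetric] by (intro mult_nonneg_nonneg) (auto simp: max_def algebra_simps)
    have "max ((1 + e) * x \<omega>) (y \<omega>) - max (x \<omega>) (y \<omega>) \<le> e * x \<omega>"
      using ex by (auto simp: max_def algebra_simps)
    then have "1 / e * (max ((1 + e) * x \<omega>) (y \<omega>) - max (x \<omega>) (y \<omega>)) \<le> 1 / e * (e * x \<omega>)"
      using e(1) by (intro mult_left_mono) auto
    then show "f n \<omega> \<le> x \<omega>"
      unfolding f_def e_def[symmetric] e(2) using e(1) by simp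
  qed
  have lim: "(\<lambda>n. f n \<omega>) \<longlonglongrightarrow> x \<omega> * indicator {\<omega>. y \<omega> \<le> x \<omega>} \<omega>" for \<omega>
  proof (cases "y \<omega> \<le> x \<omega>")
    case True
    have "f n \<omega> = x \<omega>" for n
    proof -
      have "x \<omega> \<le> (1 + 1 / real (Suc n)) * x \<omega>"
        using x(2)[of \<omega>] by (simp add: distrib_right)
      then show ?thesis
        unfolding f_def max_absorb1[OF True] max_absorb1[OF order_trans[OF True \<open>x \<omega> \<le> _\<close>]]
        by (simp add: field_simps)
    qed
    then show ?thesis using True by simp
  next
    case False
    have "(\<lambda>n. (1 + 1 / real (Suc n)) * x \<omega>) \<longlonglongrightarrow> (1 + 0) * x \<omega>"
      by (intro tendsto_intros LIMSEQ_Suc[OF lim_1_over_n])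
    then have "\<forall>\<^sub>F n in sequentially. (1 + 1 / real (Suc n)) * x \<omega> < y \<omega>"
      using False by (intro order_tendstoD(2)) auto
    then have "\<forall>\<^sub>F n in sequentially. f n \<omega> = x \<omega> * indicator {\<omega>. y \<omega> \<le> x \<omega>} \<omega>"
      by (rule eventually_mono) (use False in \<open>simp add: f_def\<close>)
    then show ?thesis by (rule tendsto_eventually)
  qed
  have "(\<lambda>n. \<integral>\<omega>. f n \<omega> \<partial>M) \<longlonglongrightarrow> (\<integral>\<omega>. x \<omega> * indicator {\<omega>. y \<omega> \<le> x \<omega>} \<omega> \<partial>M)"
  proof (rule integral_dominated_convergence[where w = x])
    show "(\<lambda>\<omega>. x \<omega> * indicator {\<omega>. y \<omega> \<le> x \<omega>} \<omega>) \<in> borel_measurable M"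
      by measurable
    show "f n \<in> borel_measurable M" for n
      unfolding f_def[abs_def] by measurable
    show "AE \<omega> in M. norm (f n \<omega>) \<le> x \<omega>" for n
      using f[of n] by auto
  qed (use x lim in auto)
  moreover have "(\<integral>\<omega>. f n \<omega> \<partial>M) = real (Suc n) * ((\<integral>\<omega>. max ((1 + 1 / real (Suc n)) * x \<omega>) (y \<omega>) \<partial>M) - (\<integral>\<omega>. max (x \<omega>) (y \<omega>) \<partial>M))" for n
    unfolding f_def using x y
    by (subst integral_mult_right_zero, subst Bochner_Integration.integral_diff) auto
  ultimately show ?thesis by simp
qed

section \<open>Finite-dimensional orthants as a generating pi-system\<close>

lemma sets_path_borel_eq_orthants:
  "sets (path_borel :: ('t \<Rightarrow> real) measure) = sigma_sets UNIV {{w. \<forall>j\<in>J. w j \<le> c j} |J c. finite J}"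
proof -
  let ?E = "{{w. \<forall>j\<in>J. w j \<le> c j} |J (c :: 't \<Rightarrow> real). finite J}"
  let ?N = "sigma UNIV ?E"
  have N: "sets ?N = sigma_sets UNIV ?E" "space ?N = UNIV"
    by (auto intro!: sets_measure_of space_measure_of)
  have coord: "(\<lambda>w. w i) \<in> borel_measurable ?N" for i
  proof (rule borel_measurableI_le)
    fix y :: real
    have "{w. w i \<le> y} \<in> ?E"
      by (intro CollectI exI[of _ "{i}"] exI[of _ "\<lambda>_. y"]) simp
    then show "{w \<in> space ?N. w i \<le> y} \<in> sets ?N"
      unfolding N by auto
  qed
  show ?thesis
  proof
    have "(\<lambda>w. w) \<in> ?N \<rightarrow>\<^sub>M path_borel"
      by (rule measurable_pathI[of "\<lambda>t w. w t"]) (rule coord)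
    then show "sets (path_borel :: ('t \<Rightarrow> real) measure) \<subseteq> sigma_sets UNIV ?E"
      unfolding N(1)[symmetric] by (auto simp: measurable_def space_PiM N(2))
    have "{w. \<forall>j\<in>J. w j \<le> c j} \<in> sets path_borel" if "finite J" for J and c :: "'t \<Rightarrow> real"
    proof -
      have "{w\<in>space path_borel. \<forall>j\<in>J. w j \<le> c j} \<in> sets path_borel"
        using that by (intro sets.sets_Collect_finite_All) auto
      then show ?thesis by (simp add: space_PiM)
    qed
    moreover have "UNIV \<in> sets (path_borel :: ('t \<Rightarrow> real) measure)"
      using sets.top[of "path_borel :: ('t \<Rightarrow> real) measure"] by (simp add: space_PiM)
    ultimately show "sigma_sets UNIV ?E \<subseteq> sets path_borel"
      by (intro sets.sigma_sets_subset') auto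
  qed
qed

text \<open>On common coordinates the smaller of the two thresholds is taken.\<close>

lemma Int_stable_orthants:
  "Int_stable {{w. \<forall>j\<in>J. w j \<le> c j} |J (c :: 't \<Rightarrow> real). finite J}"
proof (rule Int_stableI, clarify)
  fix J J' :: "'t set" and c c' :: "'t \<Rightarrow> real"
  assume fin: "finite J" "finite J'"
  let ?c = "\<lambda>j. if j \<in> J then (if j \<in> J' then min (c j) (c' j) else c j) else c' j"
  have "{w. \<forall>j\<in>J. w j \<le> c j} \<inter> {w. \<forall>j\<in>J'. w j \<le> c' j} = {w. \<forall>j\<in>J \<union> J'. w j \<le> ?c j}"
  proof (intro set_eqI iffI; clarsimp)
    fix w j assume w: "\<forall>j\<in>J \<union> J'. w j \<le> ?c j"
    show "(\<forall>j\<in>J. w j \<le> c j) \<and> (\<forall>j\<in>J'. w j \<le> c' j)"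
    proof (intro conjI ballI)
      fix j assume "j \<in> J"
      with w have "w j \<le> ?c j" by blast
      with \<open>j \<in> J\<close> show "w j \<le> c j" by (auto split: if_splits)
    next
      fix j assume "j \<in> J'"
      with w have "w j \<le> ?c j" by blast
      with \<open>j \<in> J'\<close> show "w j \<le> c' j" by (auto split: if_splits)
    qed
  qed
  note eq = this
  show "\<exists>K d. {w. \<forall>j\<in>J. w j \<le> c j} \<inter> {w. \<forall>j\<in>J'. w j \<le> c' j} = {w. \<forall>j\<in>K. w j \<le> d j} \<and> finite K"
    by (rule exI, rule exI, rule conjI, rule eq) (use fin in simp)
qed

section \<open>Shift invariance and the tilting formula\<close>

locale stationary_spectral_process = lattice_spectral_process +
  assumes stationary: "stationary_process M \<xi>"
begin

text \<open>Stationarity equates two finite-dimensional probabilities and hence their exponents;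
  these are finite, so equality of the real parts is equality.\<close>

lemma nn_integral_SUP_exp_shift:
  fixes \<tau> x :: "'i \<Rightarrow> real"
  assumes I: "finite I" and x: "\<And>i. i \<in> I \<Longrightarrow> 0 < x i"
  shows "(\<integral>\<^sup>+\<omega>. (SUP i\<in>I. ennreal (exp (W (\<tau> i + h) \<omega>) / x i)) \<partial>M)
    = (\<integral>\<^sup>+\<omega>. (SUP i\<in>I. ennreal (exp (W (\<tau> i) \<omega>) / x i)) \<partial>M)" (is "?L = ?R")
proof -
  define Q :: "(real \<Rightarrow> ennreal) \<Rightarrow> bool" where "Q w \<longleftrightarrow> (\<forall>i\<in>I. w (\<tau> i) \<le> ennreal (x i))" for w
  have Q: "Measurable.pred path_borel Q"
    unfolding Q_def pred_def using I by (intro sets.sets_Collect_finite_All) auto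
  have "process_law M (\<lambda>t. \<xi> (t + h)) = process_law M \<xi>"
    using stationary unfolding stationary_process_def by blast
  then have "prob {\<omega>\<in>space M. Q (\<lambda>t. \<xi> (t + h) \<omega>)} = prob {\<omega>\<in>space M. Q (\<lambda>t. \<xi> t \<omega>)}"
    by (rule prob_process_law_cong) (auto intro: Q)
  then have "exp (- enn2real ?L) = exp (- enn2real ?R)"
    using prob_\<xi>_le[of I x, OF I x] unfolding Q_def by simp
  then have eq: "enn2real ?L = enn2real ?R" by simp
  have "?L < \<infinity>" "?R < \<infinity>"
    by (rule nn_integral_SUP_exp_finite[OF I x]; simp)+
  then have "?L = ennreal (enn2real ?L)" "?R = ennreal (enn2real ?R)"
    by simp_all
  with eq show ?thesis by simp
qed

lemma nn_integral_SUP_X_shift: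
  fixes k :: "'i \<Rightarrow> int"
  assumes I: "finite I" and c: "\<And>i. i \<in> I \<Longrightarrow> 0 < c i"
  shows "(\<integral>\<^sup>+\<omega>. (SUP i\<in>I. ennreal (c i) * X (k i + h) \<omega>) \<partial>M) = (\<integral>\<^sup>+\<omega>. (SUP i\<in>I. ennreal (c i) * X (k i) \<omega>) \<partial>M)"
proof -
  have X: "ennreal (c i) * X l \<omega> = ennreal (exp (W (of_int l * \<delta>) \<omega>) / (1 / c i))" if "i \<in> I" for i l \<omega>
    using c[OF that] by (simp add: X_def ennreal_mult[symmetric] mult.commute)
  show ?thesis
    using nn_integral_SUP_exp_shift[of I "\<lambda>i. 1 / c i" "\<lambda>i. of_int (k i) * \<delta>" "of_int h * \<delta>"] I c
    by (simp add: X distrib_right cong: SUP_cong)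
qed

lemma mean_sup_shift:
  assumes "finite K"
  shows "mean_sup ((\<lambda>k. k + h) ` K) = mean_sup K"
  using nn_integral_SUP_X_shift[OF assms, of "\<lambda>_. 1" "\<lambda>k. k" h]
  by (simp add: mean_sup_def image_image)

definition V :: "int \<Rightarrow> 'a \<Rightarrow> real" where
  "V k \<omega> = W (of_int k * \<delta>) \<omega>"

lemma V_measurable [measurable]: "V k \<in> borel_measurable M"
  unfolding V_def[abs_def] by measurable

lemma X_V: "X k \<omega> = ennreal (exp (V k \<omega>))"
  by (simp add: X_def V_def)

lemma V_0: "AE \<omega> in M. V 0 \<omega> = 0"
  using W_0 by (simp add: V_def)

text \<open>Let \<open>Y h\<close> be the maximum of \<open>exp (- c j) * X (j + h)\<close> over
  \<open>J\<close>. The orthant event is exactly \<open>Y h \<le> X h\<close>. The mean of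
  \<open>max (s * X h) (Y h)\<close> is independent of \<open>h\<close> for every
  \<open>s > 0\<close>, and so is its right derivative at \<open>s = 1\<close>.\<close>

lemma nn_integral_X_orthant:
  assumes J: "finite J"
  shows "(\<integral>\<^sup>+\<omega>. X h \<omega> * indicator {\<omega>. \<forall>j\<in>J. V (j + h) \<omega> - V h \<omega> \<le> c j} \<omega> \<partial>M)
    = (\<integral>\<^sup>+\<omega>. X 0 \<omega> * indicator {\<omega>. \<forall>j\<in>J. V j \<omega> - V 0 \<omega> \<le> c j} \<omega> \<partial>M)"
proof -
  define Y where "Y h \<omega> = (SUP j\<in>J. ennreal (exp (- c j)) * X (j + h) \<omega>)" for h \<omega>
  have [measurable]: "Y h \<in> borel_measurable M" for h
    unfolding Y_def[abs_def] using J by (intro borel_measurable_SUP countable_finite) measurable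
  have Y_le: "Y h \<omega> \<le> (\<Sum>j\<in>J. ennreal (exp (- c j)) * X (j + h) \<omega>)" for h \<omega>
    unfolding Y_def using J by (intro SUP_least member_le_sum) auto
  have Y_top: "Y h \<omega> < top" for h \<omega>
    using Y_le by (rule le_less_trans) (use J in \<open>simp add: ennreal_mult_less_top\<close>)
  have "(\<integral>\<^sup>+\<omega>. Y h \<omega> \<partial>M) \<le> (\<integral>\<^sup>+\<omega>. (\<Sum>j\<in>J. ennreal (exp (- c j)) * X (j + h) \<omega>) \<partial>M)" for h
    by (intro nn_integral_mono Y_le)
  also have "\<And>h. (\<integral>\<^sup>+\<omega>. (\<Sum>j\<in>J. ennreal (exp (- c j)) * X (j + h) \<omega>) \<partial>M) = (\<Sum>j\<in>J. ennreal (exp (- c j)))"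
    by (subst nn_integral_sum) (auto simp: nn_integral_cmult nn_integral_X)
  finally have Y_int: "(\<integral>\<^sup>+\<omega>. Y h \<omega> \<partial>M) < \<infinity>" for h
    by (rule le_less_trans) (use J in simp)
  define x where "x h \<omega> = exp (V h \<omega>)" for h \<omega>
  define y where "y h \<omega> = enn2real (Y h \<omega>)" for h \<omega>
  have [measurable]: "x h \<in> borel_measurable M" "y h \<in> borel_measurable M" for h
    unfolding x_def[abs_def] y_def[abs_def] by measurable
  have x0: "0 \<le> x h \<omega>" and y0: "0 \<le> y h \<omega>" and yY: "ennreal (y h \<omega>) = Y h \<omega>" for h \<omega>
    using Y_top[of h \<omega>] by (auto simp: x_def y_def)
  have x: "integrable M (x h)" for h
    using nn_integral_X[of h] by (intro integrableI_bounded) (auto simp: X_V x_def)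
  have y: "integrable M (y h)" for h
    using Y_int[of h] y0 by (intro integrableI_bounded) (auto simp: yY)
  have eq: "(\<integral>\<omega>. max (s * x h \<omega>) (y h \<omega>) \<partial>M) = (\<integral>\<omega>. max (s * x 0 \<omega>) (y 0 \<omega>) \<partial>M)" if "0 < s" for s
  proof -
    \<comment> \<open>The index \<open>None\<close> carries the weight \<open>s\<close> at lag
      \<open>0\<close>. It is kept apart from \<open>Some j\<close>, since \<open>0\<close> may also
      belong to \<open>J\<close> with another weight.\<close>
    have conv: "(\<integral>\<omega>. max (s * x h \<omega>) (y h \<omega>) \<partial>M)
      = enn2real (\<integral>\<^sup>+\<omega>. (SUP i\<in>insert None (Some ` J).
          ennreal (case i of None \<Rightarrow> s | Some j \<Rightarrow> exp (- c j)) * X ((case i of None \<Rightarrow> 0 | Some j \<Rightarrow> j) + h) \<omega>) \<partial>M)" for h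
    proof -
      have "(\<integral>\<omega>. max (s * x h \<omega>) (y h \<omega>) \<partial>M) = enn2real (\<integral>\<^sup>+\<omega>. ennreal (max (s * x h \<omega>) (y h \<omega>)) \<partial>M)"
        using y0 by (intro integral_eq_nn_integral) (auto simp: le_max_iff_disj)
      also have "(\<integral>\<^sup>+\<omega>. ennreal (max (s * x h \<omega>) (y h \<omega>)) \<partial>M) = (\<integral>\<^sup>+\<omega>. (SUP i\<in>insert None (Some ` J).
          ennreal (case i of None \<Rightarrow> s | Some j \<Rightarrow> exp (- c j)) * X ((case i of None \<Rightarrow> 0 | Some j \<Rightarrow> j) + h) \<omega>) \<partial>M)"
      proof (rule nn_integral_cong)
        fix \<omega>
        have "ennreal (max (s * x h \<omega>) (y h \<omega>)) = max (ennreal (s * x h \<omega>)) (Y h \<omega>)"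
          using y0[of h \<omega>] x0[of h \<omega>] that yY[of h \<omega>] by (metis max_def ennreal_leI ennreal_le_iff)
        also have "\<dots> = (SUP i\<in>insert None (Some ` J).
          ennreal (case i of None \<Rightarrow> s | Some j \<Rightarrow> exp (- c j)) * X ((case i of None \<Rightarrow> 0 | Some j \<Rightarrow> j) + h) \<omega>)"
          using that x0[of h \<omega>] by (simp add: image_image Y_def sup_max ennreal_mult X_V x_def)
        finally show "ennreal (max (s * x h \<omega>) (y h \<omega>)) = (SUP i\<in>insert None (Some ` J).
          ennreal (case i of None \<Rightarrow> s | Some j \<Rightarrow> exp (- c j)) * X ((case i of None \<Rightarrow> 0 | Some j \<Rightarrow> j) + h) \<omega>)" .
      qed
      finally show ?thesis .
    qed
    show ?thesis
      unfolding conv using J that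
      by (subst (1 2) nn_integral_SUP_X_shift) (auto split: option.splits)
  qed
  have "(\<integral>\<omega>. x h \<omega> * indicator {\<omega>. y h \<omega> \<le> x h \<omega>} \<omega> \<partial>M) = (\<integral>\<omega>. x 0 \<omega> * indicator {\<omega>. y 0 \<omega> \<le> x 0 \<omega>} \<omega> \<partial>M)"
  proof (rule LIMSEQ_unique[OF max_scaled_integral_tendsto[OF x x0 y]])
    show "(\<lambda>n. real (Suc n) * ((\<integral>\<omega>. max ((1 + 1 / real (Suc n)) * x h \<omega>) (y h \<omega>) \<partial>M) - (\<integral>\<omega>. max (x h \<omega>) (y h \<omega>) \<partial>M)))
        \<longlonglongrightarrow> (\<integral>\<omega>. x 0 \<omega> * indicator {\<omega>. y 0 \<omega> \<le> x 0 \<omega>} \<omega> \<partial>M)"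
      using max_scaled_integral_tendsto[OF x x0 y, of 0] eq eq[of 1] by (simp add: add_pos_pos)
  qed
  moreover have key: "(\<integral>\<^sup>+\<omega>. X h \<omega> * indicator {\<omega>. \<forall>j\<in>J. V (j + h) \<omega> - V h \<omega> \<le> c j} \<omega> \<partial>M)
      = ennreal (\<integral>\<omega>. x h \<omega> * indicator {\<omega>. y h \<omega> \<le> x h \<omega>} \<omega> \<partial>M)" for h
  proof -
    have "y h \<omega> \<le> x h \<omega> \<longleftrightarrow> (\<forall>j\<in>J. V (j + h) \<omega> - V h \<omega> \<le> c j)" for \<omega>
    proof -
      have "y h \<omega> \<le> x h \<omega> \<longleftrightarrow> Y h \<omega> \<le> ennreal (x h \<omega>)"
        using x0[of h \<omega>] by (simp add: yY[symmetric])
      also have "\<dots> \<longleftrightarrow> (\<forall>j\<in>J. exp (V (j + h) \<omega> - c j) \<le> exp (V h \<omega>))"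
        by (simp add: Y_def SUP_le_iff X_V x_def ennreal_mult[symmetric] exp_add[symmetric])
      also have "\<dots> \<longleftrightarrow> (\<forall>j\<in>J. V (j + h) \<omega> - V h \<omega> \<le> c j)"
        by (auto simp: algebra_simps)
      finally show ?thesis .
    qed
    moreover have "integrable M (\<lambda>\<omega>. x h \<omega> * indicator {\<omega>. y h \<omega> \<le> x h \<omega>} \<omega>)"
      by (rule Bochner_Integration.integrable_bound[OF x]) (auto simp: x0 indicator_def)
    ultimately show ?thesis
      using x0 by (subst nn_integral_eq_integral[symmetric])
        (auto simp: X_V x_def indicator_def intro!: nn_integral_cong)
  qed
  ultimately show ?thesis
    using key[of 0] by simp
qed

text \<open>The laws of the path recentred at \<open>h\<close> under the density \<open>X h\<close>
  are finite measures agreeing on a pi-system of generators, so they do not depend on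
  \<open>h\<close>. At \<open>h = 0\<close> the density is 1 and no recentring takes place.\<close>

lemma nn_integral_tilt:
  assumes \<Gamma>: "\<Gamma> \<in> borel_measurable path_borel"
  shows "(\<integral>\<^sup>+\<omega>. X h \<omega> * \<Gamma> (\<lambda>j. V (j + h) \<omega> - V h \<omega>) \<partial>M) = (\<integral>\<^sup>+\<omega>. \<Gamma> (\<lambda>j. V j \<omega>) \<partial>M)"
proof -
  define S where "S h \<omega> = (\<lambda>j. V (j + h) \<omega> - V h \<omega>)" for h \<omega>
  have S [measurable]: "S h \<in> M \<rightarrow>\<^sub>M path_borel" for h
    unfolding S_def[abs_def] by (rule measurable_pathI) measurable
  define \<nu> where "\<nu> h = distr (density M (X h)) path_borel (S h)" for h
  let ?E = "{{w. \<forall>j\<in>J. w j \<le> c j} |J (c :: int \<Rightarrow> real). finite J}"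
  have orthant: "{w. \<forall>j\<in>J. w j \<le> c j} \<in> sets path_borel" if "finite J" for J and c :: "int \<Rightarrow> real"
    unfolding sets_path_borel_eq_orthants by (rule sigma_sets.Basic, rule CollectI, rule exI[of _ J], rule exI[of _ c]) (use that in simp)
  have emeasure_\<nu>: "emeasure (\<nu> h) A = (\<integral>\<^sup>+\<omega>. X h \<omega> * indicator A (S h \<omega>) \<partial>M)" if "A \<in> sets path_borel" for h A
  proof -
    have [measurable]: "A \<in> sets path_borel" by (rule that)
    have "emeasure (\<nu> h) A = (\<integral>\<^sup>+\<omega>. X h \<omega> * indicator (S h -` A \<inter> space M) \<omega> \<partial>M)"
      unfolding \<nu>_def by (subst emeasure_distr) (auto intro!: emeasure_density)
    also have "\<dots> = (\<integral>\<^sup>+\<omega>. X h \<omega> * indicator A (S h \<omega>) \<partial>M)"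
      by (intro nn_integral_cong) (auto simp: indicator_def)
    finally show ?thesis .
  qed
  have "\<nu> h = \<nu> 0"
  proof (rule measure_eqI_generator_eq[OF Int_stable_orthants])
    show "?E \<subseteq> Pow UNIV" by simp
    show "sets (\<nu> h) = sigma_sets UNIV ?E" "sets (\<nu> 0) = sigma_sets UNIV ?E"
      unfolding \<nu>_def by (simp_all add: sets_path_borel_eq_orthants)
    show "emeasure (\<nu> h) A = emeasure (\<nu> 0) A" if "A \<in> ?E" for A
    proof -
      from that obtain J c where A: "A = {w. \<forall>j\<in>J. w j \<le> c j}" and J: "finite J" by blast
      have "indicator A (S h \<omega>) = (indicator {\<omega>. \<forall>j\<in>J. V (j + h) \<omega> - V h \<omega> \<le> c j} \<omega> :: ennreal)" for h \<omega>
        by (simp add: A S_def indicator_def)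
      then show ?thesis
        using orthant[OF J, of c] nn_integral_X_orthant[OF J, of h c] by (simp add: emeasure_\<nu> A)
    qed
    have "(UNIV :: (int \<Rightarrow> real) set) \<in> ?E"
      by (intro CollectI exI[of _ "{}"] exI[of _ "\<lambda>_. 0"]) simp
    then show "range (\<lambda>_::nat. UNIV) \<subseteq> ?E" by (intro image_subsetI)
    show "emeasure (\<nu> h) UNIV \<noteq> \<infinity>" for i :: nat
      using orthant[of "{}"] by (simp add: emeasure_\<nu> nn_integral_X)
  qed simp
  have int: "(\<integral>\<^sup>+w. \<Gamma> w \<partial>\<nu> h) = (\<integral>\<^sup>+\<omega>. X h \<omega> * \<Gamma> (S h \<omega>) \<partial>M)" for h
    unfolding \<nu>_def using \<Gamma> by (simp add: nn_integral_distr nn_integral_density)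
  have "(\<integral>\<^sup>+\<omega>. X h \<omega> * \<Gamma> (S h \<omega>) \<partial>M) = (\<integral>\<^sup>+\<omega>. X 0 \<omega> * \<Gamma> (S 0 \<omega>) \<partial>M)"
    unfolding int[symmetric] \<open>\<nu> h = \<nu> 0\<close> ..
  also have "\<dots> = (\<integral>\<^sup>+\<omega>. \<Gamma> (\<lambda>j. V j \<omega>) \<partial>M)"
    using X_0 V_0 by (intro nn_integral_cong_AE, eventually_elim) (simp add: S_def)
  finally show ?thesis
    unfolding S_def .
qed

end

subsection \<open>Pickands constants\<close>

text \<open>Cesaro averaging.\<close>

lemma mean_tendsto:
  fixes e :: "nat \<Rightarrow> real"
  assumes "e \<longlonglongrightarrow> d"
  shows "(\<lambda>n. (\<Sum>k<n. e k) / real n) \<longlonglongrightarrow> d"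
proof (rule LIMSEQ_I)
  fix \<epsilon> :: real assume \<epsilon>: "0 < \<epsilon>"
  then obtain N where N: "\<And>k. N \<le> k \<Longrightarrow> \<bar>e k - d\<bar> < \<epsilon> / 2"
    using LIMSEQ_D[OF assms, of "\<epsilon> / 2"] by auto
  define C where "C = (\<Sum>k<N. \<bar>e k - d\<bar>)"
  \<comment> \<open>Beyond \<open>m\<close> the fixed error \<open>C\<close> of the initial block is
    less than half of the allowed total.\<close>
  obtain m :: nat where m: "2 * C / \<epsilon> < real m"
    using reals_Archimedean2 by blast
  show "\<exists>no. \<forall>n\<ge>no. norm ((\<Sum>k<n. e k) / real n - d) < \<epsilon>"
  proof (intro exI allI impI)
    fix n assume "N + Suc m \<le> n"
    then have n: "N \<le> n" "m < n" by auto
    have "2 * C < \<epsilon> * real m"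
      using m \<epsilon> by (simp add: divide_less_eq mult.commute)
    also have "\<dots> \<le> \<epsilon> * real n"
      using n \<epsilon> by simp
    finally have C: "C < \<epsilon> / 2 * real n" by simp
    have "(\<Sum>k<n. \<bar>e k - d\<bar>) = C + (\<Sum>k\<in>{N..<n}. \<bar>e k - d\<bar>)"
      unfolding C_def lessThan_atLeast0 using n by (intro sum.atLeastLessThan_concat[symmetric]) auto
    also have "(\<Sum>k\<in>{N..<n}. \<bar>e k - d\<bar>) \<le> (\<Sum>k\<in>{N..<n}. \<epsilon> / 2)"
      using N by (intro sum_mono less_imp_le) auto
    also have "\<dots> \<le> \<epsilon> / 2 * real n"
      using n \<epsilon> by (simp add: mult_right_mono)
    finally have "(\<Sum>k<n. \<bar>e k - d\<bar>) < \<epsilon> * real n"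
      using C by simp
    then have "\<bar>\<Sum>k<n. e k - d\<bar> < \<epsilon> * real n"
      by (rule le_less_trans[OF sum_abs])
    moreover have "(\<Sum>k<n. e k) / real n - d = (\<Sum>k<n. e k - d) / real n"
      using n by (simp add: sum_subtractf field_simps)
    ultimately show "norm ((\<Sum>k<n. e k) / real n - d) < \<epsilon>"
      using n by (simp add: divide_less_eq)
  qed
qed

lemma real_nat_floor_div_tendsto:
  fixes \<delta> :: real
  assumes \<delta>: "0 < \<delta>"
  shows "((\<lambda>T. real (nat \<lfloor>T / \<delta>\<rfloor>) / T) \<longlongrightarrow> 1 / \<delta>) at_top"
proof (rule tendsto_sandwich[OF _ _ _ tendsto_const])
  have T: "\<forall>\<^sub>F T in at_top. 0 < (T::real)"
    by (rule eventually_gt_at_top)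
  show "\<forall>\<^sub>F T in at_top. 1 / \<delta> - 1 / T \<le> real (nat \<lfloor>T / \<delta>\<rfloor>) / T"
    using T
  proof eventually_elim
    case (elim T)
    have "T / \<delta> - 1 \<le> real (nat \<lfloor>T / \<delta>\<rfloor>)" by linarith
    then have "(T / \<delta> - 1) / T \<le> real (nat \<lfloor>T / \<delta>\<rfloor>) / T"
      using elim by (intro divide_right_mono) auto
    then show ?case using elim by (simp add: diff_divide_distrib)
  qed
  show "\<forall>\<^sub>F T in at_top. real (nat \<lfloor>T / \<delta>\<rfloor>) / T \<le> 1 / \<delta>"
    using T
  proof eventually_elim
    case (elim T)
    have "0 \<le> T / \<delta>" using elim \<delta> by simp
    then have "real (nat \<lfloor>T / \<delta>\<rfloor>) \<le> T / \<delta>" by linarith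
    then have "real (nat \<lfloor>T / \<delta>\<rfloor>) / T \<le> T / \<delta> / T"
      using elim by (intro divide_right_mono) auto
    then show ?case using elim by simp
  qed
  have "((\<lambda>T. 1 / \<delta> - 1 / T) \<longlongrightarrow> 1 / \<delta> - 0) at_top"
    by (intro tendsto_intros tendsto_divide_0[OF tendsto_const] filterlim_at_top_imp_at_infinity filterlim_ident)
  then show "((\<lambda>T. 1 / \<delta> - 1 / T) \<longlongrightarrow> 1 / \<delta>) at_top" by simp
qed

lemma ennreal_mult_diff_distrib:
  fixes a b c :: ennreal
  assumes "0 < c" "c < top"
  shows "c * (a - b) = c * a - c * b"
proof -
  obtain r where r: "c = ennreal r" "0 < r"
    using assms by (cases c) auto
  show ?thesis
  proof (cases a; cases b)
    fix x y :: real assume "0 \<le> x" "a = ennreal x" "0 \<le> y" "b = ennreal y"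
    then show ?thesis
      using r by (simp add: ennreal_minus ennreal_mult'[symmetric] right_diff_distrib)
  qed (use r in \<open>auto simp: ennreal_mult_top ennreal_top_mult ennreal_mult'[symmetric]\<close>)
qed

text \<open>Both sides are the positive part of \<open>1 - s\<close>. Finiteness of \<open>s\<close>
  matters because \<open>top - top = top\<close>.\<close>

lemma ennreal_max_diff: "max 1 s - s = 1 - min 1 s" if "s < top" for s :: ennreal
  using that by (auto simp: max_def min_def diff_eq_0_ennreal)

section \<open>Deterministic two-sided sequences tending to minus infinity\<close>

context
  fixes w :: "int \<Rightarrow> real"
  assumes w: "filterlim w at_bot (filtercomap abs at_top)"
begin

lemma dissipative_obtain_bound:
  obtains N :: nat where "\<And>k. int N \<le> \<bar>k\<bar> \<Longrightarrow> w k < C"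
proof -
  have "\<forall>\<^sub>F k in filtercomap abs at_top. w k < C"
    using w by (auto simp: filterlim_at_bot_dense)
  then obtain N where "\<And>k. N \<le> \<bar>k\<bar> \<Longrightarrow> w k < C"
    unfolding eventually_filtercomap eventually_at_top_linorder by blast
  then show ?thesis
    by (intro that[of "nat N"]) (auto split: if_splits)
qed

lemma dissipative_finite_superlevel: "finite {k. C \<le> w k}"
proof -
  obtain N :: nat where N: "\<And>k. int N \<le> \<bar>k\<bar> \<Longrightarrow> w k < C"
    by (rule dissipative_obtain_bound[of C]) blast
  have "{k. C \<le> w k} \<subseteq> {- int N..int N}"
  proof
    fix k assume "k \<in> {k. C \<le> w k}"
    then have "\<not> int N \<le> \<bar>k\<bar>" using N[of k] by auto
    then show "k \<in> {- int N..int N}" by auto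
  qed
  then show ?thesis by (rule finite_subset) simp
qed

text \<open>Only finitely many indices reach the value at a chosen \<open>k0\<close>, and the
  maximum over them is the maximum over \<open>K\<close>.\<close>

lemma dissipative_attains_sup:
  assumes "K \<noteq> {}"
  shows "\<exists>j\<in>K. \<forall>i\<in>K. w i \<le> w j"
proof -
  obtain k0 where k0: "k0 \<in> K" using assms by blast
  let ?F = "{k\<in>K. w k0 \<le> w k}"
  have F: "finite ?F" "?F \<noteq> {}"
    using finite_subset[OF _ dissipative_finite_superlevel[of "w k0"], of ?F] k0 by auto
  have "Max (w ` ?F) \<in> w ` ?F"
    using F by (intro Max_in) auto
  then obtain j where j: "j \<in> ?F" "w j = Max (w ` ?F)" by force
  have "w i \<le> w j" if "i \<in> K" for i
  proof (cases "w k0 \<le> w i")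
    case True
    then show ?thesis
      using that F(1) unfolding j(2) by (intro Max_ge) auto
  next
    case False
    then show ?thesis using j(1) by auto
  qed
  then show ?thesis using j(1) by blast
qed

lemma dissipative_first_argmax: "\<exists>j. (\<forall>i<j. w i < w j) \<and> (\<forall>i. w i \<le> w j)"
proof -
  obtain m where m: "\<And>i. w i \<le> w m"
    using dissipative_attains_sup[of UNIV] by auto
  let ?F = "{k. w m \<le> w k}"
  have F: "finite ?F" "?F \<noteq> {}"
    using dissipative_finite_superlevel by auto
  define j where "j = Min ?F"
  have j: "w m \<le> w j"
    using Min_in[OF F] by (simp add: j_def)
  have "w i < w j" if "i < j" for i
  proof (rule ccontr)
    assume "\<not> w i < w j"
    then have "i \<in> ?F" using j by simp
    then have "j \<le> i" unfolding j_def using F by (intro Min_le) auto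
    then show False using that by simp
  qed
  moreover have "w i \<le> w j" for i
    using m[of i] j by simp
  ultimately show ?thesis by blast
qed

lemma dissipative_SUP_exp_less_top: "(SUP i\<in>{k..}. ennreal (exp (w i))) < top"
proof -
  obtain m where m: "\<And>i. w i \<le> w m"
    using dissipative_attains_sup[of UNIV] by auto
  have "(SUP i\<in>{k..}. ennreal (exp (w i))) \<le> ennreal (exp (w m))"
    using m by (intro SUP_least ennreal_leI) simp
  then show ?thesis by (rule le_less_trans) simp
qed

lemma dissipative_tail_SUP_tendsto:
  "(\<lambda>n. enn2real (SUP i\<in>{int n..}. ennreal (exp (w i)))) \<longlonglongrightarrow> 0"
proof (rule LIMSEQ_I)
  fix e :: real assume e: "0 < e"
  obtain N :: nat where N: "\<And>k. int N \<le> \<bar>k\<bar> \<Longrightarrow> w k < ln (e / 2)"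
    by (rule dissipative_obtain_bound[of "ln (e / 2)"]) blast
  show "\<exists>no. \<forall>n\<ge>no. norm (enn2real (SUP i\<in>{int n..}. ennreal (exp (w i))) - 0) < e"
  proof (intro exI allI impI)
    fix n assume n: "N \<le> n"
    have "(SUP i\<in>{int n..}. ennreal (exp (w i))) \<le> ennreal (e / 2)"
    proof (intro SUP_least ennreal_leI)
      fix i assume "i \<in> {int n..}"
      then have "w i < ln (e / 2)"
        using n by (intro N) auto
      then have "exp (w i) < exp (ln (e / 2))" by simp
      then show "exp (w i) \<le> e / 2"
        using e by simp
    qed
    then have "enn2real (SUP i\<in>{int n..}. ennreal (exp (w i))) \<le> e / 2"
      using e by (intro enn2real_leI) auto
    then show "norm (enn2real (SUP i\<in>{int n..}. ennreal (exp (w i))) - 0) < e"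
      using e by simp
  qed
qed

text \<open>The tail suprema are finite, decreasing and tend to 0, so the series of their drops
  telescopes; it is evaluated with the real values \<open>t n\<close>.\<close>

lemma dissipative_suminf_SUP_exp:
  "(\<Sum>n. (SUP i\<in>{int n..}. ennreal (exp (w i))) - (SUP i\<in>{int n + 1..}. ennreal (exp (w i))))
    = (SUP i\<in>{0..}. ennreal (exp (w i)))"
proof -
  define t where "t n = enn2real (SUP i\<in>{int n..}. ennreal (exp (w i)))" for n
  have t: "(SUP i\<in>{int n..}. ennreal (exp (w i))) = ennreal (t n)" for n
    using dissipative_SUP_exp_less_top[of "int n"] by (simp add: t_def)
  have "ennreal (t (Suc n)) \<le> ennreal (t n)" for n
    unfolding t[symmetric] by (intro SUP_subset_mono) auto
  then have dec: "t (Suc n) \<le> t n" for n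
    by (simp add: t_def)
  have "(\<lambda>n. t n - t (Suc n)) sums (t 0 - 0)"
    using dissipative_tail_SUP_tendsto by (intro telescope_sums') (simp add: t_def)
  then have "(\<Sum>n. ennreal (t n - t (Suc n))) = ennreal (t 0)"
    using dec by (intro suminf_ennreal_eq) auto
  moreover have "(SUP i\<in>{int n + 1..}. ennreal (exp (w i))) = ennreal (t (Suc n))" for n
    using t[of "Suc n"] by (simp add: add.commute)
  moreover have "0 \<le> t n" for n
    by (simp add: t_def)
  ultimately show ?thesis
    using t[of 0] by (simp add: t ennreal_minus)
qed

end

text \<open>Strictness to the left selects the leftmost maximizer, so at most one index qualifies
  and the events for different \<open>j\<close> are disjoint.\<close>

definition first_argmax :: "int \<Rightarrow> (int \<Rightarrow> real) \<Rightarrow> bool" where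
  "first_argmax j w \<longleftrightarrow> (\<forall>i<j. w i < w j) \<and> (\<forall>i. w i \<le> w j)"

lemma first_argmax_unique: "first_argmax j w \<Longrightarrow> first_argmax k w \<Longrightarrow> j = k"
  unfolding first_argmax_def by (meson leD linorder_neqE)

lemma first_argmax_measurable [measurable]: "Measurable.pred path_borel (first_argmax j)"
proof -
  have c: "(\<lambda>w. w i) \<in> borel_measurable (path_borel :: (int \<Rightarrow> real) measure)" for i
    by simp
  have [measurable]: "Measurable.pred path_borel (\<lambda>w. w i < (w j :: real))" for i
    unfolding pred_def by (rule borel_measurable_less[OF c c])
  have [measurable]: "Measurable.pred path_borel (\<lambda>w. w i \<le> (w j :: real))" for i
    unfolding pred_def by (rule borel_measurable_le[OF c c])
  show ?thesis
    unfolding first_argmax_def by measurable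
qed

lemma first_argmax_shift:
  "first_argmax 0 (\<lambda>i. w (i + j) - w j) \<longleftrightarrow> first_argmax j w"
proof -
  have "(\<forall>i<0. w (i + j) < w j) \<longleftrightarrow> (\<forall>i<j. w i < w j)"
  proof (intro iffI allI impI)
    fix i assume *: "\<forall>i<0. w (i + j) < w j" and "i < j"
    then show "w i < w j" using *[rule_format, of "i - j"] by simp
  qed simp
  moreover have "(\<forall>i. w (i + j) \<le> w j) \<longleftrightarrow> (\<forall>i. w i \<le> w j)"
  proof (intro iffI allI)
    fix i assume *: "\<forall>i. w (i + j) \<le> w j"
    show "w i \<le> w j" using *[rule_format, of "i - j"] by simp
  qed simp
  ultimately show ?thesis
    by (simp add: first_argmax_def)
qed

text \<open>A supremum of negative numbers may be zero; here the supremum over negative indices is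
  attained, so it stays strictly below zero.\<close>

lemma first_argmax_iff_SUP:
  assumes w: "filterlim w at_bot (filtercomap abs at_top)" and w0: "w 0 = 0"
  shows "(SUP i\<in>{..<0}. ereal (w i)) < 0 \<and> 0 = (SUP i. ereal (w i)) \<longleftrightarrow> first_argmax 0 w"
proof
  assume *: "(SUP i\<in>{..<0}. ereal (w i)) < 0 \<and> 0 = (SUP i. ereal (w i))"
  have "ereal (w i) < 0" if "i < 0" for i
  proof -
    have "ereal (w i) \<le> (SUP i\<in>{..<0}. ereal (w i))"
      using that by (intro SUP_upper) simp
    also have "\<dots> < 0"
      using * by (rule conjunct1)
    finally show ?thesis .
  qed
  moreover have "ereal (w i) \<le> 0" for i
  proof -
    have "ereal (w i) \<le> (SUP i. ereal (w i))"
      by (intro SUP_upper) simp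
    also have "\<dots> = 0"
      by (rule sym[OF conjunct2[OF *]])
    finally show ?thesis .
  qed
  ultimately show "first_argmax 0 w"
    unfolding first_argmax_def w0 by (simp add: zero_ereal_def)
next
  assume max: "first_argmax 0 w"
  obtain j where j: "j < 0" "\<And>i. i < 0 \<Longrightarrow> w i \<le> w j"
    using dissipative_attains_sup[OF w, of "{..<0}"] by auto
  have "(SUP i\<in>{..<0}. ereal (w i)) \<le> ereal (w j)"
    using j by (intro SUP_least) auto
  also have "\<dots> < 0"
    using max j(1) w0 by (simp add: first_argmax_def)
  finally have "(SUP i\<in>{..<0}. ereal (w i)) < 0" .
  moreover have "(SUP i. ereal (w i)) = 0"
    using max w0 SUP_upper[of 0 UNIV "\<lambda>i. ereal (w i)"]
    by (intro antisym SUP_least) (auto simp: first_argmax_def zero_ereal_def)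
  ultimately show "(SUP i\<in>{..<0}. ereal (w i)) < 0 \<and> 0 = (SUP i. ereal (w i))"
    by simp
qed

text \<open>With \<open>S\<close> the supremum of \<open>exp (v i)\<close>, the event is
  \<open>E \<le> - ln S\<close>, of probability \<open>1 - S\<close> when \<open>S < 1\<close>.
  Otherwise it forces \<open>E \<le> 0\<close>, which has probability zero.\<close>

lemma (in prob_space) emeasure_exponential_shift_le:
  assumes E: "distributed M lborel E (exponential_density 1)"
  shows "emeasure M {\<omega>\<in>space M. \<forall>i\<in>I. E \<omega> + v i \<le> 0} = 1 - min 1 (SUP i\<in>I. ennreal (exp (v i)))"
proof -
  have [measurable]: "E \<in> borel_measurable M"
    using E by (simp add: distributed_def)
  let ?S = "SUP i\<in>I. ennreal (exp (v i))"
  have le_iff: "(\<forall>i\<in>I. E \<omega> + v i \<le> 0) \<longleftrightarrow> ?S \<le> ennreal (exp (- E \<omega>))" for \<omega>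
    by (auto simp: SUP_le_iff)
  show ?thesis
  proof (cases "?S < 1")
    case True
    then have fin: "?S < top" by (rule less_trans) simp
    define s where "s = enn2real ?S"
    have s: "?S = ennreal s" "0 \<le> s"
      using fin by (simp_all add: s_def)
    have "s < 1" using True s by (simp add: s)
    show ?thesis
    \<comment> \<open>The value 0 arises only from an empty \<open>I\<close>; it is split off
      because the threshold \<open>- ln s\<close> makes sense only for positive
      \<open>s\<close>.\<close>
    proof (cases "s = 0")
      case True
      then have "{\<omega>\<in>space M. \<forall>i\<in>I. E \<omega> + v i \<le> 0} = space M"
        by (simp add: le_iff s)
      then show ?thesis
        using True by (simp add: s emeasure_space_1)
    next
      case False
      then have s0: "0 < s" using s by simp
      have "?S \<le> ennreal (exp (- E \<omega>)) \<longleftrightarrow> E \<omega> \<le> - ln s" for \<omega>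
      proof -
        have "?S \<le> ennreal (exp (- E \<omega>)) \<longleftrightarrow> s \<le> exp (- E \<omega>)"
          unfolding s(1) by simp
        also have "\<dots> \<longleftrightarrow> ln s \<le> - E \<omega>"
          using s0 by (metis exp_le_cancel_iff exp_ln)
        also have "\<dots> \<longleftrightarrow> E \<omega> \<le> - ln s" by linarith
        finally show ?thesis .
      qed
      then have "emeasure M {\<omega>\<in>space M. \<forall>i\<in>I. E \<omega> + v i \<le> 0} = ennreal \<P>(\<omega> in M. E \<omega> \<le> - ln s)"
        by (simp add: le_iff emeasure_eq_measure)
      also have "\<P>(\<omega> in M. E \<omega> \<le> - ln s) = 1 - s"
        using exponential_distributedD_le[OF E, of "- ln s"] s0 \<open>s < 1\<close> by simp
      also have "ennreal (1 - s) = 1 - min 1 ?S"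
        using s0 \<open>s < 1\<close> unfolding s(1) by (simp add: min_def ennreal_minus[symmetric])
      finally show ?thesis .
    qed
  next
    case False
    then have "1 \<le> ?S" by simp
    have "emeasure M {\<omega>\<in>space M. \<forall>i\<in>I. E \<omega> + v i \<le> 0} \<le> emeasure M {\<omega>\<in>space M. E \<omega> \<le> 0}"
    proof (intro emeasure_mono subsetI)
      fix \<omega> assume "\<omega> \<in> {\<omega>\<in>space M. \<forall>i\<in>I. E \<omega> + v i \<le> 0}"
      then have "?S \<le> ennreal (exp (- E \<omega>))" "\<omega> \<in> space M"
        using le_iff by auto
      then have "1 \<le> ennreal (exp (- E \<omega>))"
        by (intro order_trans[OF \<open>1 \<le> ?S\<close>])
      then have "E \<omega> \<le> 0"
        by simp
      then show "\<omega> \<in> {\<omega>\<in>space M. E \<omega> \<le> 0}"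
        using \<open>\<omega> \<in> space M\<close> by simp
    qed simp
    also have "\<dots> = 0"
      using exponential_distributedD_le[OF E, of 0] by (simp add: emeasure_eq_measure)
    finally show ?thesis
      using \<open>1 \<le> ?S\<close> by (simp add: min_absorb1)
  qed
qed

section \<open>The Pickands constant in the dissipative case\<close>

locale dissipative_spectral_process = stationary_spectral_process +
  assumes \<delta>_pos: "0 < \<delta>"
    and dissipative: "AE \<omega> in M. filterlim (\<lambda>k. V k \<omega>) at_bot (filtercomap abs at_top)"
begin

text \<open>This is E (1 - sup)^+ for the supremum of \<open>X k\<close> over
  \<open>k \<ge> 1\<close>, the common value to which all expressions for the Pickands constant are
  reduced, up to the factor \<open>1 / \<delta>\<close>.\<close>

definition gap :: real where
  "gap = 1 - enn2real (mean_sup_1 {1..})"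

lemma ennreal_gap: "ennreal gap = 1 - mean_sup_1 {1..}"
proof -
  have "mean_sup_1 {1..} = ennreal (enn2real (mean_sup_1 {1..}))"
    using le_less_trans[OF mean_sup_1_le, of top] by simp
  then show ?thesis
    unfolding gap_def by (metis enn2real_nonneg ennreal_1 ennreal_minus)
qed

lemma gap_nonneg: "0 \<le> gap"
  using enn2real_mono[OF mean_sup_1_le[of "{1..}"]] by (simp add: gap_def)

lemma nn_integral_one_minus_min_SUP:
  "(\<integral>\<^sup>+\<omega>. 1 - min 1 (SUP i\<in>{1..}. X i \<omega>) \<partial>M) = ennreal gap"
proof -
  have "(\<integral>\<^sup>+\<omega>. 1 - min 1 (SUP i\<in>{1..}. X i \<omega>) \<partial>M) = (\<integral>\<^sup>+\<omega>. 1 \<partial>M) - mean_sup_1 {1..}"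
    unfolding mean_sup_1_def using le_less_trans[OF mean_sup_1_le[of "{1..}"], of top]
    by (intro nn_integral_diff) (auto simp: mean_sup_1_def)
  then show ?thesis
    by (simp add: emeasure_space_1 ennreal_gap)
qed

text \<open>Stationarity moves the window by one, and adding the index \<open>0\<close> then costs
  the mean of one minus the truncated supremum.\<close>

lemma mean_sup_Suc:
  "enn2real (mean_sup {0..int (Suc n)}) = enn2real (mean_sup {0..int n}) + (1 - enn2real (mean_sup_1 {1..int (Suc n)}))"
proof -
  have ins: "insert 0 {1..int (Suc n)} = {0..int (Suc n)}"
    by auto
  have "(\<lambda>k. k + 1) ` {0..int n} = {1..int (Suc n)}"
    by (simp add: add.commute)
  then have "mean_sup {1..int (Suc n)} = mean_sup {0..int n}"
    using mean_sup_shift[of "{0..int n}" 1] by (simp add: add.commute)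
  then have "mean_sup {0..int (Suc n)} + mean_sup_1 {1..int (Suc n)} = mean_sup {0..int n} + 1"
    using mean_sup_insert_0[of "{1..int (Suc n)}"] unfolding ins by simp
  then have "enn2real (mean_sup {0..int (Suc n)} + mean_sup_1 {1..int (Suc n)}) = enn2real (mean_sup {0..int n} + 1)"
    by (rule arg_cong)
  then show ?thesis
    using mean_sup_less_top[of "{0..int (Suc n)}"] mean_sup_less_top[of "{0..int n}"]
      le_less_trans[OF mean_sup_1_le[of "{1..int (Suc n)}"], of top] by (simp add: enn2real_plus)
qed

text \<open>The increments converge to \<open>gap\<close>, hence so do their averages; the initial
  value is divided away.\<close>

lemma mean_sup_average_tendsto:
  "(\<lambda>n. enn2real (mean_sup {0..int n}) / real n) \<longlonglongrightarrow> gap"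
proof -
  let ?e = "\<lambda>n. 1 - enn2real (mean_sup_1 {1..int (Suc n)})"
  have "incseq (\<lambda>n. {1..int (Suc n)})"
    by (intro monoI) auto
  moreover have "(\<Union>n. {1..int (Suc n)}) = {1..}"
  proof (intro set_eqI iffI)
    fix k :: int assume "k \<in> {1..}"
    then have "k \<in> {1..int (Suc (nat k))}" by simp
    then show "k \<in> (\<Union>n. {1..int (Suc n)})" by blast
  qed auto
  ultimately have "(\<lambda>n. mean_sup_1 {1..int (Suc n)}) \<longlonglongrightarrow> mean_sup_1 {1..}"
    using mean_sup_1_UN_incseq[of "\<lambda>n. {1..int (Suc n)}"] by simp
  then have "(\<lambda>n. enn2real (mean_sup_1 {1..int (Suc n)})) \<longlonglongrightarrow> enn2real (mean_sup_1 {1..})"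
    using le_less_trans[OF mean_sup_1_le, of top] by (intro tendsto_enn2real) auto
  then have "?e \<longlonglongrightarrow> gap"
    unfolding gap_def by (rule tendsto_diff[OF tendsto_const])
  then have "(\<lambda>n. (\<Sum>k<n. ?e k) / real n) \<longlonglongrightarrow> gap"
    by (rule mean_tendsto)
  moreover have sum: "enn2real (mean_sup {0..int n}) = enn2real (mean_sup {0}) + (\<Sum>k<n. ?e k)" for n
    by (induction n) (simp_all add: mean_sup_Suc del: of_nat_Suc)
  moreover have "(\<lambda>n. enn2real (mean_sup {0}) * (1 / real n)) \<longlonglongrightarrow> enn2real (mean_sup {0}) * 0"
    by (intro tendsto_intros lim_1_over_n)
  ultimately have "(\<lambda>n. enn2real (mean_sup {0}) * (1 / real n) + (\<Sum>k<n. ?e k) / real n) \<longlonglongrightarrow> enn2real (mean_sup {0}) * 0 + gap"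
    by (intro tendsto_add)
  then show ?thesis
    unfolding sum by (simp add: add_divide_distrib)
qed

text \<open>The grid points in \<open>{0..T}\<close> are the multiples \<open>k * \<delta>\<close>
  with \<open>0 \<le> k \<le> \<lfloor>T / \<delta>\<rfloor>\<close>, so the real-valued supremum is
  a finite maximum.\<close>

lemma pickands_ratio_eq:
  assumes T: "0 < T"
  shows "pickands_ratio M W \<delta> T = enn2real (mean_sup {0..int (nat \<lfloor>T / \<delta>\<rfloor>)}) / T"
proof -
  let ?N = "int (nat \<lfloor>T / \<delta>\<rfloor>)"
  have N: "?N = \<lfloor>T / \<delta>\<rfloor>" using T \<delta>_pos by simp
  have K: "range (\<lambda>k::int. \<delta> * of_int k) \<inter> {0..T} = (\<lambda>k. of_int k * \<delta>) ` {0..?N}"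
  proof (intro set_eqI iffI)
    fix t assume "t \<in> range (\<lambda>k::int. \<delta> * of_int k) \<inter> {0..T}"
    then obtain k :: int where k: "t = of_int k * \<delta>" "0 \<le> of_int k * \<delta>" "of_int k * \<delta> \<le> T"
      by (auto simp: mult.commute)
    then have "0 \<le> k" using \<delta>_pos by (simp add: zero_le_mult_iff)
    moreover have "k \<le> \<lfloor>T / \<delta>\<rfloor>"
      using k \<delta>_pos by (simp add: le_floor_iff le_divide_eq)
    ultimately show "t \<in> (\<lambda>k. of_int k * \<delta>) ` {0..?N}"
      using k(1) N by auto
  next
    fix t assume "t \<in> (\<lambda>k. of_int k * \<delta>) ` {0..?N}"
    then obtain k where "t = of_int k * \<delta>" "k \<in> {0..?N}" by blast
    then have k: "t = of_int k * \<delta>" "0 \<le> k" "k \<le> \<lfloor>T / \<delta>\<rfloor>"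
      unfolding N by simp_all
    then show "t \<in> range (\<lambda>k::int. \<delta> * of_int k) \<inter> {0..T}"
      using \<delta>_pos by (auto simp: le_floor_iff le_divide_eq mult.commute)
  qed
  have SUP: "(SUP t\<in>range (\<lambda>k::int. \<delta> * of_int k) \<inter> {0..T}. exp (W t \<omega>)) = enn2real (SUP k\<in>{0..?N}. X k \<omega>)" for \<omega>
  proof -
    have fin: "finite ((\<lambda>k. exp (V k \<omega>)) ` {0..?N})" "(\<lambda>k. exp (V k \<omega>)) ` {0..?N} \<noteq> {}"
      by auto
    have "(SUP k\<in>{0..?N}. X k \<omega>) = ennreal (Max ((\<lambda>k. exp (V k \<omega>)) ` {0..?N}))"
    proof (intro antisym SUP_least)
      show "X k \<omega> \<le> ennreal (Max ((\<lambda>k. exp (V k \<omega>)) ` {0..?N}))" if "k \<in> {0..?N}" for k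
        unfolding X_V using fin that by (intro ennreal_leI Max_ge) auto
      have "Max ((\<lambda>k. exp (V k \<omega>)) ` {0..?N}) \<in> (\<lambda>k. exp (V k \<omega>)) ` {0..?N}"
        using fin by (rule Max_in)
      then obtain k where k: "k \<in> {0..?N}" "Max ((\<lambda>k. exp (V k \<omega>)) ` {0..?N}) = exp (V k \<omega>)"
        by blast
      show "ennreal (Max ((\<lambda>k. exp (V k \<omega>)) ` {0..?N})) \<le> (SUP k\<in>{0..?N}. X k \<omega>)"
        unfolding k(2) X_V[symmetric] using k(1) by (rule SUP_upper)
    qed
    moreover have "0 \<le> Max ((\<lambda>k. exp (V k \<omega>)) ` {0..?N})"
      using fin by (subst Max_ge_iff) auto
    moreover have "(SUP t\<in>range (\<lambda>k::int. \<delta> * of_int k) \<inter> {0..T}. exp (W t \<omega>)) = Max ((\<lambda>k. exp (V k \<omega>)) ` {0..?N})"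
      unfolding K image_image V_def[symmetric] using fin by (rule cSup_eq_Max)
    ultimately show ?thesis by simp
  qed
  have "(\<integral>\<omega>. enn2real (SUP k\<in>{0..?N}. X k \<omega>) \<partial>M) = enn2real (\<integral>\<^sup>+\<omega>. ennreal (enn2real (SUP k\<in>{0..?N}. X k \<omega>)) \<partial>M)"
    by (intro integral_eq_nn_integral) auto
  also have "(\<integral>\<^sup>+\<omega>. ennreal (enn2real (SUP k\<in>{0..?N}. X k \<omega>)) \<partial>M) = mean_sup {0..?N}"
    unfolding mean_sup_def
  proof (intro nn_integral_cong)
    fix \<omega>
    have "(SUP k\<in>{0..?N}. X k \<omega>) \<le> (\<Sum>k\<in>{0..?N}. X k \<omega>)"
      by (intro SUP_least member_le_sum) auto
    also have "\<dots> < top" by simp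
    finally show "ennreal (enn2real (SUP k\<in>{0..?N}. X k \<omega>)) = (SUP k\<in>{0..?N}. X k \<omega>)"
      by simp
  qed
  finally show ?thesis
    unfolding pickands_ratio_def SUP by simp
qed

lemma pickands_ratio_tendsto: "(pickands_ratio M W \<delta> \<longlongrightarrow> 1 / \<delta> * gap) at_top"
proof -
  let ?N = "\<lambda>T. nat \<lfloor>T / \<delta>\<rfloor>"
  have div: "filterlim (\<lambda>T. T / \<delta>) at_top at_top"
    using \<delta>_pos by (intro filterlim_at_top_mult_tendsto_pos[OF tendsto_const, of "1 / \<delta>", simplified] filterlim_ident) auto
  have N: "filterlim ?N at_top at_top"
    by (intro filterlim_compose[OF filterlim_nat_sequentially] filterlim_compose[OF filterlim_floor_sequentially] div)
  have "((\<lambda>T. real (?N T) / T * (enn2real (mean_sup {0..int (?N T)}) / real (?N T))) \<longlongrightarrow> 1 / \<delta> * gap) at_top"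
    by (intro tendsto_mult real_nat_floor_div_tendsto \<delta>_pos filterlim_compose[OF mean_sup_average_tendsto N])
  moreover have "\<forall>\<^sub>F T in at_top. 0 < ?N T"
    using eventually_compose_filterlim[OF eventually_gt_at_top[of 0] N] .
  then have "\<forall>\<^sub>F T in at_top. real (?N T) / T * (enn2real (mean_sup {0..int (?N T)}) / real (?N T)) = pickands_ratio M W \<delta> T"
    using eventually_gt_at_top[of 0]
  proof eventually_elim
    case (elim T)
    define n where "n = ?N T"
    have "0 < n" using elim(1) unfolding n_def .
    then show ?case
      unfolding pickands_ratio_eq[OF elim(2)] n_def[symmetric] by simp
  qed
  ultimately show ?thesis
    by (rule Lim_transform_eventually)
qed

lemma pickands_eq: "pickands M W \<delta> = 1 / \<delta> * gap"
  unfolding pickands_def by (rule tendsto_Lim[OF _ pickands_ratio_tendsto]) simp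

lemma AE_SUP_X_less_top: "AE \<omega> in M. (SUP i\<in>{k..}. X i \<omega>) < top"
  using dissipative by eventually_elim (simp add: X_V dissipative_SUP_exp_less_top)

text \<open>Pointwise, the difference is the positive part of one minus the supremum over
  \<open>{1..}\<close>. Each supremum is almost surely finite, which keeps the subtraction
  meaningful.\<close>

lemma nn_integral_SUP_X_diff:
  "(\<integral>\<^sup>+\<omega>. (SUP i\<in>{0..}. X i \<omega>) - (SUP i\<in>{1..}. X i \<omega>) \<partial>M) = ennreal gap"
  unfolding nn_integral_one_minus_min_SUP[symmetric]
proof (rule nn_integral_cong_AE)
  show "AE \<omega> in M. (SUP i\<in>{0..}. X i \<omega>) - (SUP i\<in>{1..}. X i \<omega>) = 1 - min 1 (SUP i\<in>{1..}. X i \<omega>)"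
    using AE_SUP_X_less_top[of 1] X_0
  proof eventually_elim
    case (elim \<omega>)
    have "{0::int..} = insert 0 {1..}" by auto
    then have "(SUP i\<in>{0..}. X i \<omega>) = max 1 (SUP i\<in>{1..}. X i \<omega>)"
      using elim(2) by (simp add: sup_max)
    then show ?case
      using elim(1) by (simp add: ennreal_max_diff)
  qed
qed

lemma sup_exp_increment_eq: "sup_exp_increment M V = gap"
  unfolding sup_exp_increment_def X_V[symmetric] nn_integral_SUP_X_diff using gap_nonneg by simp

text \<open>With the path of \<open>W\<close> frozen, the exponential law gives the conditional
  probability as one minus the truncated supremum, whose mean is \<open>gap\<close>.\<close>

lemma prob_exponential_le:
  assumes E: "distributed M lborel E (exponential_density 1)"
    and indep: "indep_rv M borel E path_borel (\<lambda>\<omega> t. W t \<omega>)"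
  shows "\<P>(\<omega> in M. (SUP i\<in>{1..}. ereal (E \<omega> + V i \<omega>)) \<le> 0) = gap"
proof -
  define A where "A = {z\<in>space (path_borel \<Otimes>\<^sub>M borel). \<forall>i\<in>{1::int..}. snd z + fst z (of_int i * \<delta>) \<le> (0 :: real)}"
  have c: "(\<lambda>z. fst z t) \<in> borel_measurable (path_borel \<Otimes>\<^sub>M borel)" for t :: real
    by (rule measurable_path_component[OF measurable_fst])
  have "{z\<in>space (path_borel \<Otimes>\<^sub>M borel). snd z + fst z t \<le> (0 :: real)} \<in> sets (path_borel \<Otimes>\<^sub>M borel)" for t :: real
    by (rule borel_measurable_le[OF borel_measurable_add[OF measurable_snd c] measurable_const]) simp
  then have A: "A \<in> sets (path_borel \<Otimes>\<^sub>M borel)"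
    unfolding A_def by (intro sets.sets_Collect_countable_Ball) auto
  have in_A: "((\<lambda>t. W t \<omega>), e) \<in> A \<longleftrightarrow> (\<forall>i\<in>{1::int..}. e + V i \<omega> \<le> 0)" for \<omega> e
    by (auto simp: A_def V_def space_pair_measure space_PiM)
  have "emeasure M {\<omega>\<in>space M. ((\<lambda>t. W t \<omega>), E \<omega>) \<in> A}
      = (\<integral>\<^sup>+\<omega>. emeasure M {\<eta>\<in>space M. ((\<lambda>t. W t \<omega>), E \<eta>) \<in> A} \<partial>M)"
    by (rule indep_rv_emeasure[OF indep_rv_sym[OF indep] A])
  also have "\<dots> = ennreal gap"
    unfolding in_A emeasure_exponential_shift_le[OF E] nn_integral_one_minus_min_SUP[symmetric] X_V ..
  finally have "\<P>(\<omega> in M. \<forall>i\<in>{1::int..}. E \<omega> + V i \<omega> \<le> 0) = gap"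
    using gap_nonneg by (simp add: in_A emeasure_eq_measure)
  moreover have "(SUP i\<in>{1..}. ereal (E \<omega> + V i \<omega>)) \<le> 0 \<longleftrightarrow> (\<forall>i\<in>{1..}. E \<omega> + V i \<omega> \<le> 0)" for \<omega>
    by (simp add: SUP_le_iff zero_ereal_def)
  ultimately show ?thesis by simp
qed

text \<open>The variable \<open>X 1\<close> is strictly positive, so the truncated supremum has
  positive mean.\<close>

lemma gap_less_1: "gap < 1"
proof -
  have "mean_sup_1 {1..} \<noteq> 0"
  proof
    assume "mean_sup_1 {1..} = 0"
    then have "AE \<omega> in M. min 1 (SUP k\<in>{1..}. X k \<omega>) = 0"
      unfolding mean_sup_1_def by (subst (asm) nn_integral_0_iff_AE) auto
    then have "AE \<omega> in M. False"
    proof eventually_elim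
      case (elim \<omega>)
      have "0 < X 1 \<omega>" by simp
      also have "X 1 \<omega> \<le> (SUP k\<in>{1..}. X k \<omega>)" by (intro SUP_upper) simp
      finally show False using elim by (auto simp: min_def split: if_splits)
    qed
    then show False by simp
  qed
  then have "0 < enn2real (mean_sup_1 {1..})"
    using le_less_trans[OF mean_sup_1_le[of "{1..}"], of top] by (simp add: enn2real_positive_iff zero_less_iff_neq_zero)
  then show ?thesis by (simp add: gap_def)
qed

lemma V_path [measurable]: "(\<lambda>\<omega> j. V j \<omega>) \<in> M \<rightarrow>\<^sub>M path_borel"
  by (rule measurable_pathI) measurable

lemma first_argmax_event [measurable]: "Measurable.pred M (\<lambda>\<omega>. first_argmax j (\<lambda>i. V i \<omega>))"
  using measurable_compose[OF V_path first_argmax_measurable] .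

text \<open>Mass transport: \<open>X 0 - sup\<^bsub>i\<ge>1\<^esub> X i\<close> is split according to the position \<open>-n\<close> of the
  first maximum, each part is moved to the event that the maximum is at \<open>0\<close>, and the sum
  telescopes.\<close>

lemma gap_eq_prob_first_argmax:
  "ennreal gap = emeasure M {\<omega>\<in>space M. first_argmax 0 (\<lambda>i. V i \<omega>)}"
proof -
  \<comment> \<open>The drop of the tail supremum when the index \<open>n\<close> is removed.
    Recentring at \<open>-n\<close> and multiplying by \<open>X (-n)\<close> turns it into \<Delta>,
    the drop at the index \<open>0\<close>.\<close>
  define D where "D n w = (SUP i\<in>{int n..}. ennreal (exp (w i))) - (SUP i\<in>{int n + 1..}. ennreal (exp (w i)))"
    for n and w :: "int \<Rightarrow> real"
  define \<Gamma> where "\<Gamma> n w = (if first_argmax 0 w then D n w else 0)" for n w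
  define \<Delta> where "\<Delta> \<omega> = (SUP i\<in>{0..}. X i \<omega>) - (SUP i\<in>{1..}. X i \<omega>)" for \<omega>
  have [measurable]: "(\<lambda>w. SUP i\<in>K. ennreal (exp (w i))) \<in> borel_measurable (path_borel :: (int \<Rightarrow> real) measure)" for K
    by (intro borel_measurable_SUP measurable_compose[OF measurable_component_singleton]) auto
  have [measurable]: "\<Gamma> n \<in> borel_measurable path_borel" for n
    unfolding \<Gamma>_def[abs_def] D_def by measurable
  have [measurable]: "\<Delta> \<in> borel_measurable M"
    unfolding \<Delta>_def[abs_def] by measurable
  have shift: "X (- int n) \<omega> * \<Gamma> n (\<lambda>j. V (j + - int n) \<omega> - V (- int n) \<omega>)
      = (if first_argmax (- int n) (\<lambda>i. V i \<omega>) then \<Delta> \<omega> else 0)" for n \<omega>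
  proof -
    have "X (- int n) \<omega> * (SUP i\<in>{int n + l..}. ennreal (exp (V (i + - int n) \<omega> - V (- int n) \<omega>)))
        = (SUP i\<in>{l..}. X i \<omega>)" for l
    proof -
      have "X (- int n) \<omega> * (SUP i\<in>{int n + l..}. ennreal (exp (V (i + - int n) \<omega> - V (- int n) \<omega>)))
          = (SUP i\<in>{int n + l..}. X (i + - int n) \<omega>)"
        unfolding SUP_mult_left_ennreal by (simp add: X_V ennreal_mult[symmetric] exp_add[symmetric])
      also have "\<dots> = (SUP i\<in>(\<lambda>i. i + - int n) ` {int n + l..}. X i \<omega>)"
        by (simp add: image_image)
      also have "(\<lambda>i. i + - int n) ` {int n + l..} = {l..}"
      proof (intro set_eqI iffI)
        fix i assume "i \<in> {l..}"
        then have "i = (i + int n) + - int n" "i + int n \<in> {int n + l..}" by auto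
        then show "i \<in> (\<lambda>i. i + - int n) ` {int n + l..}" by blast
      qed auto
      finally show ?thesis .
    qed
    from this[of 0] this[of 1]
    have "X (- int n) \<omega> * D n (\<lambda>j. V (j + - int n) \<omega> - V (- int n) \<omega>) = \<Delta> \<omega>"
      unfolding D_def \<Delta>_def by (simp add: ennreal_mult_diff_distrib)
    then show ?thesis
      using first_argmax_shift[of "\<lambda>i. V i \<omega>" "- int n"] by (simp add: \<Gamma>_def)
  qed
  have "ennreal gap = (\<integral>\<^sup>+\<omega>. \<Delta> \<omega> \<partial>M)"
    unfolding \<Delta>_def by (rule nn_integral_SUP_X_diff[symmetric])
  also have "\<dots> = (\<integral>\<^sup>+\<omega>. (\<Sum>n. if first_argmax (- int n) (\<lambda>i. V i \<omega>) then \<Delta> \<omega> else 0) \<partial>M)"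
  proof (rule nn_integral_cong_AE)
    show "AE \<omega> in M. \<Delta> \<omega> = (\<Sum>n. if first_argmax (- int n) (\<lambda>i. V i \<omega>) then \<Delta> \<omega> else 0)"
      using dissipative AE_SUP_X_less_top[of 1]
    proof eventually_elim
      case (elim \<omega>)
      obtain j where j: "first_argmax j (\<lambda>i. V i \<omega>)"
        using dissipative_first_argmax[OF elim(1)] unfolding first_argmax_def by blast
      show ?case
      \<comment> \<open>A first maximum at \<open>j \<le> 0\<close> is found by exactly one
        \<open>n\<close>. If \<open>j > 0\<close>, the supremum over nonnegative indices is already
        attained at a positive one, so \<Delta> vanishes and the empty sum is correct.\<close>
      proof (cases "j \<le> 0")
        case True
        have "first_argmax (- int n) (\<lambda>i. V i \<omega>) \<longleftrightarrow> n = nat (- j)" for n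
          using first_argmax_unique[OF j, of "- int n"] j True by auto
        then have "(\<Sum>n. if first_argmax (- int n) (\<lambda>i. V i \<omega>) then \<Delta> \<omega> else 0)
            = (\<Sum>n\<in>{nat (- j)}. if first_argmax (- int n) (\<lambda>i. V i \<omega>) then \<Delta> \<omega> else 0)"
          by (intro suminf_finite) auto
        then show ?thesis using j True by simp
      next
        case False
        then have "\<not> first_argmax (- int n) (\<lambda>i. V i \<omega>)" for n
          using first_argmax_unique[OF j, of "- int n"] by auto
        moreover have "\<Delta> \<omega> = 0"
        proof -
          have "(SUP i\<in>{0..}. X i \<omega>) \<le> X j \<omega>"
            using j unfolding X_V first_argmax_def by (intro SUP_least ennreal_leI) auto
          also have "\<dots> \<le> (SUP i\<in>{1..}. X i \<omega>)"
            using False by (intro SUP_upper) auto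
          finally show ?thesis
            unfolding \<Delta>_def using elim(2) by (simp add: diff_eq_0_iff_ennreal)
        qed
        ultimately show ?thesis by simp
      qed
    qed
  qed
  also have "\<dots> = (\<Sum>n. \<integral>\<^sup>+\<omega>. (if first_argmax (- int n) (\<lambda>i. V i \<omega>) then \<Delta> \<omega> else 0) \<partial>M)"
    by (rule nn_integral_suminf) measurable
  \<comment> \<open>The tilt with \<open>h = -n\<close> moves the first maximum from
    \<open>-n\<close> to \<open>0\<close> and absorbs the factor \<open>X (-n)\<close>.\<close>
  also have "\<dots> = (\<Sum>n. \<integral>\<^sup>+\<omega>. \<Gamma> n (\<lambda>j. V j \<omega>) \<partial>M)"
    unfolding shift[symmetric] by (intro suminf_cong nn_integral_tilt) measurable
  also have "\<dots> = (\<integral>\<^sup>+\<omega>. (\<Sum>n. \<Gamma> n (\<lambda>j. V j \<omega>)) \<partial>M)"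
    by (rule nn_integral_suminf[symmetric]) measurable
  also have "\<dots> = (\<integral>\<^sup>+\<omega>. indicator {\<omega>\<in>space M. first_argmax 0 (\<lambda>i. V i \<omega>)} \<omega> \<partial>M)"
  proof (rule nn_integral_cong_AE)
    show "AE \<omega> in M. (\<Sum>n. \<Gamma> n (\<lambda>j. V j \<omega>)) = indicator {\<omega>\<in>space M. first_argmax 0 (\<lambda>i. V i \<omega>)} \<omega>"
      using dissipative V_0 AE_space
    proof eventually_elim
      case (elim \<omega>)
      show ?case
      proof (cases "first_argmax 0 (\<lambda>i. V i \<omega>)")
        \<comment> \<open>With the maximum at \<open>0\<close> the drops telescope to the supremum
          over \<open>{0..}\<close>, which equals 1 because \<open>V 0 = 0\<close>.\<close>
        case True
        have "(SUP i\<in>{0..}. ennreal (exp (V i \<omega>))) = 1"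
        proof (rule antisym)
          show "(SUP i\<in>{0..}. ennreal (exp (V i \<omega>))) \<le> 1"
            using True elim(2) by (intro SUP_least) (auto simp: first_argmax_def)
          have "ennreal (exp (V 0 \<omega>)) \<le> (SUP i\<in>{0..}. ennreal (exp (V i \<omega>)))"
            by (intro SUP_upper) simp
          then show "1 \<le> (SUP i\<in>{0..}. ennreal (exp (V i \<omega>)))"
            using elim(2) by simp
        qed
        then show ?thesis
          using True elim(3) dissipative_suminf_SUP_exp[OF elim(1)] by (simp add: \<Gamma>_def D_def)
      qed (simp add: \<Gamma>_def)
    qed
  qed
  also have "\<dots> = emeasure M {\<omega>\<in>space M. first_argmax 0 (\<lambda>i. V i \<omega>)}"
    by simp
  finally show ?thesis .
qed

text \<open>If \<open>gap\<close> were zero, a first maximum at \<open>0\<close> would have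
  probability zero, and by the tilt so would one at each \<open>j\<close>. Countably many null
  events cannot cover the almost sure existence of a first maximum.\<close>

lemma gap_pos: "0 < gap"
proof (rule ccontr)
  assume "\<not> 0 < gap"
  then have "emeasure M {\<omega>\<in>space M. first_argmax 0 (\<lambda>i. V i \<omega>)} = 0"
    using gap_nonneg gap_eq_prob_first_argmax by simp
  moreover have "(\<integral>\<^sup>+\<omega>. (if first_argmax 0 (\<lambda>i. V i \<omega>) then 1 else 0) \<partial>M)
      = (\<integral>\<^sup>+\<omega>. indicator {\<omega>\<in>space M. first_argmax 0 (\<lambda>i. V i \<omega>)} \<omega> \<partial>M)"
    by (intro nn_integral_cong) (simp add: indicator_def)
  ultimately have "(\<integral>\<^sup>+\<omega>. (if first_argmax 0 (\<lambda>i. V i \<omega>) then 1 else 0) \<partial>M) = 0"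
    by simp
  then have "(\<integral>\<^sup>+\<omega>. X j \<omega> * (if first_argmax j (\<lambda>i. V i \<omega>) then 1 else 0) \<partial>M) = 0" for j
    using nn_integral_tilt[of "\<lambda>w. if first_argmax 0 w then 1 else 0" j]
      first_argmax_shift[of "\<lambda>i. V i _" j] by simp
  then have "AE \<omega> in M. X j \<omega> * (if first_argmax j (\<lambda>i. V i \<omega>) then 1 else 0) = 0" for j
    by (subst (asm) nn_integral_0_iff_AE) auto
  then have "AE \<omega> in M. \<forall>j. X j \<omega> * (if first_argmax j (\<lambda>i. V i \<omega>) then 1 else 0) = 0"
    by (simp add: AE_all_countable)
  then have "AE \<omega> in M. False"
    using dissipative
  proof eventually_elim
    case (elim \<omega>)
    obtain j where "first_argmax j (\<lambda>i. V i \<omega>)"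
      using dissipative_first_argmax[OF elim(2)] unfolding first_argmax_def by blast
    then show False
      using elim(1)[rule_format, of j] X_pos[of j \<omega>] by simp
  qed
  then show False by simp
qed

lemma prob_first_argmax:
  "\<P>(\<omega> in M. (SUP i\<in>{..<0}. ereal (V i \<omega>)) < 0 \<and> 0 = (SUP i. ereal (V i \<omega>))) = gap"
proof -
  have "\<P>(\<omega> in M. (SUP i\<in>{..<0}. ereal (V i \<omega>)) < 0 \<and> 0 = (SUP i. ereal (V i \<omega>)))
      = \<P>(\<omega> in M. first_argmax 0 (\<lambda>i. V i \<omega>))"
  proof (rule prob_eq_AE)
    show "AE \<omega> in M. ((SUP i\<in>{..<0}. ereal (V i \<omega>)) < 0 \<and> 0 = (SUP i. ereal (V i \<omega>))) \<longleftrightarrow> first_argmax 0 (\<lambda>i. V i \<omega>)"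
      using dissipative V_0 by eventually_elim (rule first_argmax_iff_SUP)
  qed measurable
  then show ?thesis
    using gap_eq_prob_first_argmax gap_nonneg by (simp add: emeasure_eq_measure)
qed

end

theorem theorem2p1:
  fixes M :: "'a measure"
    and B W :: "real \<Rightarrow> 'a \<Rightarrow> real"
    and P :: "nat \<Rightarrow> 'a \<Rightarrow> real"
    and Wc :: "nat \<Rightarrow> real \<Rightarrow> 'a \<Rightarrow> real"
    and \<xi> :: "real \<Rightarrow> 'a \<Rightarrow> ennreal"
    and \<delta> :: real
    and W\<delta> :: "int \<Rightarrow> 'a \<Rightarrow> real"
  assumes "prob_space M"
    and "\<And>t. B t \<in> borel_measurable M"
    and "\<And>\<omega>. \<omega> \<in> space M \<Longrightarrow> cadlag (\<lambda>t. B t \<omega>)"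
    and "AE \<omega> in M. B 0 \<omega> = 0"
    and "\<And>t. integrable M (\<lambda>\<omega>. exp (B t \<omega>))"
    and "W = exp_normalized M B"
    and "poisson_point_process M frechet_intensity P"
    and "\<And>i. process_law M (Wc i) = process_law M W"
    and "prob_space.indep_vars M (\<lambda>_. path_borel) (\<lambda>i \<omega> t. Wc i t \<omega>) UNIV"
    and "indep_rv M (\<Pi>\<^sub>M i\<in>UNIV. frechet_intensity) (\<lambda>\<omega> i. P i \<omega>)
                    (\<Pi>\<^sub>M i\<in>UNIV. path_borel) (\<lambda>\<omega> i t. Wc i t \<omega>)"
    and "\<xi> = spectral_sup P Wc"
    and "max_stable_process M \<xi>"
    and "stationary_process M \<xi>"
    and "\<delta> > 0"
    and "W\<delta> = (\<lambda>i. W (\<delta> * of_int i))"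
  shows "((AE \<omega> in M. filterlim (\<lambda>z::int. W (of_int z * \<delta>) \<omega>) at_bot (filtercomap abs at_top))
            \<longleftrightarrow> finite_mean_cluster_size M \<xi> \<delta>)
       \<and> ((AE \<omega> in M. filterlim (\<lambda>z::int. W (of_int z * \<delta>) \<omega>) at_bot (filtercomap abs at_top))
          \<longrightarrow> (pickands_ratio M W \<delta> \<longlongrightarrow> pickands M W \<delta>) at_top
            \<and> pickands M W \<delta> =
                1 / \<delta> * \<P>(\<omega> in M. (SUP i\<in>{..<0}. ereal (W\<delta> i \<omega>)) < 0
                                   \<and> 0 = (SUP i. ereal (W\<delta> i \<omega>)))
            \<and> (\<forall>E. distributed M lborel E (exponential_density 1)
                   \<and> indep_rv M borel E path_borel (\<lambda>\<omega> t. W t \<omega>)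
                 \<longrightarrow> pickands M W \<delta> =
                       1 / \<delta> * \<P>(\<omega> in M. (SUP i\<in>{1..}. ereal (E \<omega> + W\<delta> i \<omega>)) \<le> 0))
            \<and> pickands M W \<delta> = 1 / \<delta> * sup_exp_increment M W\<delta>
            \<and> 0 < pickands M W \<delta> \<and> pickands M W \<delta> < 1 / \<delta>)"
proof -
  interpret prob_space M by (rule assms(1))
  note [measurable] = assms(2)
  define c where "c t = (LINT \<eta>|M. exp (B t \<eta>))" for t
  have W: "W t \<omega> = B t \<omega> - ln (c t)" for t \<omega>
    by (simp add: assms(6) exp_normalized_def c_def)
  \<comment> \<open>Positivity makes \<open>ln (c t)\<close> a genuine logarithm, so that
    \<open>exp (W t)\<close> is \<open>exp (B t) / c t\<close> and has mean 1.\<close>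
  have c_pos: "0 < c t" for t
  proof -
    have "c t \<noteq> 0"
    proof
      assume "c t = 0"
      then have "AE \<omega> in M. exp (B t \<omega>) = 0"
        unfolding c_def using integral_nonneg_eq_0_iff_AE[OF assms(5)[of t]] by simp
      then show False by simp
    qed
    moreover have "0 \<le> c t" unfolding c_def by simp
    ultimately show ?thesis by simp
  qed
  have c_0: "c 0 = 1"
  proof -
    have "c 0 = (LINT \<eta>|M. 1)"
      unfolding c_def using assms(4) by (intro integral_cong_AE) auto
    then show ?thesis by (simp add: prob_space)
  qed
  interpret stationary_spectral_process M W P Wc \<xi> \<delta>
  proof unfold_locales
    show "W t \<in> borel_measurable M" for t
      unfolding W[abs_def] by measurable
    show "AE \<omega> in M. W 0 \<omega> = 0"
      using assms(4) by eventually_elim (simp add: W c_0)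
    show "(\<integral>\<^sup>+\<omega>. ennreal (exp (W t \<omega>)) \<partial>M) = 1" for t
    proof -
      have "(\<integral>\<^sup>+\<omega>. ennreal (exp (W t \<omega>)) \<partial>M) = ennreal (LINT \<omega>|M. exp (B t \<omega>) / c t)"
        using c_pos[of t] assms(5)[of t]
        by (subst nn_integral_eq_integral[symmetric]) (auto simp: W exp_diff less_imp_le)
      then show ?thesis
        using c_pos[of t] by (simp add: c_def[symmetric])
    qed
  qed (use assms in auto)
  have W\<delta>: "W\<delta> = V"
    by (intro ext) (simp add: assms(15) V_def mult.commute)
  show ?thesis
  proof (intro conjI impI)
    show "(AE \<omega> in M. filterlim (\<lambda>z::int. W (of_int z * \<delta>) \<omega>) at_bot (filtercomap abs at_top))
        \<longleftrightarrow> finite_mean_cluster_size M \<xi> \<delta>"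
      by (rule finite_mean_cluster_size_iff_dissipative[symmetric])
  next
    assume "AE \<omega> in M. filterlim (\<lambda>z::int. W (of_int z * \<delta>) \<omega>) at_bot (filtercomap abs at_top)"
    then interpret dissipative_spectral_process M W P Wc \<xi> \<delta>
      using assms(14) by unfold_locales (simp_all add: V_def)
    show "(pickands_ratio M W \<delta> \<longlongrightarrow> pickands M W \<delta>) at_top"
      unfolding pickands_eq by (rule pickands_ratio_tendsto)
    show "pickands M W \<delta> = 1 / \<delta> * \<P>(\<omega> in M. (SUP i\<in>{..<0}. ereal (W\<delta> i \<omega>)) < 0
                                   \<and> 0 = (SUP i. ereal (W\<delta> i \<omega>)))"
      unfolding W\<delta> pickands_eq prob_first_argmax ..
    show "\<forall>E. distributed M lborel E (exponential_density 1)
                   \<and> indep_rv M borel E path_borel (\<lambda>\<omega> t. W t \<omega>)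
                 \<longrightarrow> pickands M W \<delta> =
                       1 / \<delta> * \<P>(\<omega> in M. (SUP i\<in>{1..}. ereal (E \<omega> + W\<delta> i \<omega>)) \<le> 0)"
      unfolding W\<delta> pickands_eq using prob_exponential_le by simp
    show "pickands M W \<delta> = 1 / \<delta> * sup_exp_increment M W\<delta>"
      unfolding W\<delta> pickands_eq sup_exp_increment_eq ..
    show "0 < pickands M W \<delta>"
      unfolding pickands_eq using gap_pos \<delta>_pos by simp
    show "pickands M W \<delta> < 1 / \<delta>"
      unfolding pickands_eq using gap_less_1 \<delta>_pos by (simp add: divide_strict_right_mono)
  qed
qed

end
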